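(* Let $\mathcal S$ be a finite set of $n\ge 1$ two-bar charts all of which are big, i.e. $\max\{a_i,b_i\}>\frac12$ for all $i\in\mathcal S$, and let $OPT$ be the minimal length of a feasible packing of $\mathcal S$. Then Algorithm App finds, in $O(n^{2.5})$ time, a feasible packing of $\mathcal S$ of length at most $\frac43\,OPT+\frac23$. This performance guarantee is tight: there exist a set of big 2-BCs and an execution of Algorithm App on it (with an admissible resolution of the arbitrary choices in the algorithm) whose output packing has length exactly $\frac43\,OPT+\frac23$.
   Context: A two-bar chart (2-BC) $i$ is an ordered pair of bars with heights $a_i$ (first, or left, bar) and $b_i$ (second, or right, bar), where $a_i,b_i\in(0,1]$. A bar is big if its height is greater than $\frac12$; a 2-BC is big if at least one of its bars is big. For integers $k\le r$, $[k,r]=\{k,k+1,\ldots,r\}$. Given a finite set $\mathcal S$ of $n\ge 1$ 2-BCs and $2n$ unit-capacity bins numbered $1,\ldots,2n$, a packing is a function $p:\mathcal S\to[1,2n-1]$; the first bar of $i$ is put in bin $p(i)$ and its second bar in bin $p(i)+1$. Let $B_k=\{i\in\mathcal S\mid p(i)=k\}$ for $k\in[1,2n]$ and $B_0=\emptyset$. The packing is feasible if $\sum_{i\in B_k}a_i+\sum_{i\in B_{k-1}}b_i\le 1$ for all $k\in[1,2n]$. Only feasible packings are considered. The length $L(p)$ of a packing $p$ is the number of bins containing at least one bar. Algorithm GALO. Sort all 2-BCs into a list in lexicographically non-increasing order of $(a_i,b_i)$ (non-increasing $a_i$, ties broken by non-increasing $b_i$, remaining ties arbitrarily). Process bins $k=1,2,\ldots$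 in turn until all 2-BCs are packed: at bin $k$, take the first 2-BC $y$ in the current list (if any) whose first bar can be placed in bin $k$, that is, if a 2-BC $x$ was assigned $p(x)=k-1$, then $b_x+a_y\le 1$ is required, and if no 2-BC was assigned to $k-1$, then $y$ is simply the first 2-BC of the list; set $p(y)=k$ and remove $y$ from the list; if no such $y$ exists, assign no 2-BC to $k$. Then move to the next bin. The resulting packing is $p^g$. Algorithm Matching. Build the graph $G=(\mathcal S,E)$ in which distinct 2-BCs $i,j$ are adjacent if and only if $a_i+a_j\le1$ and $b_i+b_j\le1$. Find a matching $M$ of maximum cardinality in $G$. Construct a feasible packing $p^m$ in which, for each $(i,j)\in M$, the 2-BCs $i$ and $j$ are packed in the same two consecutive bins, i.e. $p^m(i)=p^m(j)$, and the remaining 2-BCs are assigned to bins in any way (keeping feasibility; e.g. each matched pair and each unmatched 2-BC may be given two consecutive bins of its own). Algorithm App. Find $p^g$ by GALO and $p^m$ by Algorithm Matching, and output the one of smaller length, denoted $p^a$. Running time is measured in elementary arithmetic operations and comparisons on heights. *)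

theory Defs
  imports Complex_Main "HOL-Library.FuncSet" "HOL-Library.Disjoint_Sets"
    "HOL-Library.Landau_Symbols"
begin

section \<open>Two-bar charts and packings\<close>

text \<open>
  A two-bar chart is a label \<open>i \<in> S\<close> whose bars have heights \<open>a i\<close> and \<open>b i\<close>, so distinct
  charts may have equal heights.
\<close>

definition two_bar_charts :: "'i set \<Rightarrow> ('i \<Rightarrow> real) \<Rightarrow> ('i \<Rightarrow> real) \<Rightarrow> bool" where
  "two_bar_charts S a b \<longleftrightarrow>
     finite S \<and> S \<noteq> {} \<and> (\<forall>i\<in>S. a i \<in> {0<..1} \<and> b i \<in> {0<..1})"

definition big :: "('i \<Rightarrow> real) \<Rightarrow> ('i \<Rightarrow> real) \<Rightarrow> 'i \<Rightarrow> bool" where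
  "big a b i \<longleftrightarrow> a i > 1/2 \<or> b i > 1/2"

definition starts_in :: "'i set \<Rightarrow> ('i \<Rightarrow> nat) \<Rightarrow> nat \<Rightarrow> 'i set" where
  "starts_in S p k = {i \<in> S. p i = k}"

text \<open>
  Only the values of a packing on \<open>S\<close> matter. For \<open>k = 1\<close> the second sum below is empty,
  because no chart of a packing starts in bin \<open>0\<close>.
\<close>

definition feasible :: "'i set \<Rightarrow> ('i \<Rightarrow> real) \<Rightarrow> ('i \<Rightarrow> real) \<Rightarrow> ('i \<Rightarrow> nat) \<Rightarrow> bool" where
  "feasible S a b p \<longleftrightarrow>
     p \<in> S \<rightarrow> {1..2 * card S - 1} \<and>
     (\<forall>k\<in>{1..2 * card S}.
        (\<Sum>i\<in>starts_in S p k. a i) + (\<Sum>i\<in>starts_in S p (k - 1). b i) \<le> 1)"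

definition packing_length :: "'i set \<Rightarrow> ('i \<Rightarrow> nat) \<Rightarrow> nat" where
  "packing_length S p = card {k \<in> {1..2 * card S}. \<exists>i\<in>S. p i = k \<or> p i + 1 = k}"

definition OPT :: "'i set \<Rightarrow> ('i \<Rightarrow> real) \<Rightarrow> ('i \<Rightarrow> real) \<Rightarrow> nat" where
  "OPT S a b = (LEAST l. \<exists>p. feasible S a b p \<and> packing_length S p = l)"


section \<open>Algorithm GALO\<close>

definition lex_ge :: "('i \<Rightarrow> real) \<Rightarrow> ('i \<Rightarrow> real) \<Rightarrow> 'i \<Rightarrow> 'i \<Rightarrow> bool" where
  "lex_ge a b x y \<longleftrightarrow> a x > a y \<or> (a x = a y \<and> b x \<ge> b y)"

definition lex_list :: "'i set \<Rightarrow> ('i \<Rightarrow> real) \<Rightarrow> ('i \<Rightarrow> real) \<Rightarrow> 'i list \<Rightarrow> bool" where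
  "lex_list S a b xs \<longleftrightarrow> distinct xs \<and> set xs = S \<and> sorted_wrt (lex_ge a b) xs"

fun fits_after :: "('i \<Rightarrow> real) \<Rightarrow> ('i \<Rightarrow> real) \<Rightarrow> 'i option \<Rightarrow> 'i \<Rightarrow> bool" where
  "fits_after a b None y \<longleftrightarrow> True"
| "fits_after a b (Some x) y \<longleftrightarrow> b x + a y \<le> 1"

text \<open>
  In \<open>galo a b k prev ys\<close>, the bin to be processed is \<open>k\<close>, the charts not yet packed are \<open>ys\<close>,
  and \<open>prev\<close> is the chart that was assigned to bin \<open>k - 1\<close>, if any.
\<close>

function galo :: "('i \<Rightarrow> real) \<Rightarrow> ('i \<Rightarrow> real) \<Rightarrow> nat \<Rightarrow> 'i option \<Rightarrow> 'i list \<Rightarrow> 'i \<Rightarrow> nat" where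
  "galo a b k prev [] = (\<lambda>_. 0)"
| "galo a b k prev (z # zs) =
     (case find (fits_after a b prev) (z # zs) of
        None \<Rightarrow> galo a b (k + 1) None (z # zs)
      | Some y \<Rightarrow> (galo a b (k + 1) (Some y) (remove1 y (z # zs)))(y := k))"
  by pat_completeness auto

lemma find_Some_length_remove1:
  "find P xs = Some y \<Longrightarrow> length (remove1 y xs) < length xs"
  by (auto simp: find_Some_iff length_remove1)

termination
proof (relation "measure (\<lambda>(a, b, k, prev, ys). 2 * length ys + (if prev = None then 0 else 1))",
    goal_cases)
  case 1
  show ?case by simp
next
  case (2 a b k prev z zs)
  then have "prev \<noteq> None" by (cases prev) auto
  then show ?case by simp
next
  case (3 a b k prev z zs y)
  from find_Some_length_remove1[OF 3] show ?case by (simp split: if_splits)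
qed

definition galo_packing ::
  "'i set \<Rightarrow> ('i \<Rightarrow> real) \<Rightarrow> ('i \<Rightarrow> real) \<Rightarrow> ('i \<Rightarrow> nat) \<Rightarrow> bool" where
  "galo_packing S a b p \<longleftrightarrow>
     (\<exists>xs. lex_list S a b xs \<and> (\<forall>i\<in>S. p i = galo a b 1 None xs i))"


section \<open>Algorithm Matching\<close>

definition chart_edges :: "'i set \<Rightarrow> ('i \<Rightarrow> real) \<Rightarrow> ('i \<Rightarrow> real) \<Rightarrow> 'i set set" where
  "chart_edges S a b =
     {{i, j} | i j. i \<in> S \<and> j \<in> S \<and> i \<noteq> j \<and> a i + a j \<le> 1 \<and> b i + b j \<le> 1}"

definition matching :: "'v set set \<Rightarrow> 'v set set \<Rightarrow> bool" where
  "matching E M \<longleftrightarrow> M \<subseteq> E \<and> pairwise disjnt M"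

definition maximum_matching :: "'v set set \<Rightarrow> 'v set set \<Rightarrow> bool" where
  "maximum_matching E M \<longleftrightarrow> matching E M \<and> (\<forall>M'. matching E M' \<longrightarrow> card M' \<le> card M)"

definition matching_packing ::
  "'i set \<Rightarrow> ('i \<Rightarrow> real) \<Rightarrow> ('i \<Rightarrow> real) \<Rightarrow> 'i set set \<Rightarrow> ('i \<Rightarrow> nat) \<Rightarrow> bool" where
  "matching_packing S a b M p \<longleftrightarrow>
     feasible S a b p \<and> (\<forall>i j. {i, j} \<in> M \<longrightarrow> p i = p j)"


section \<open>Algorithm App\<close>

text \<open>
  \<open>app_run S a b pg M pm pa\<close>: some execution of App computes the GALO packing \<open>pg\<close>, the maximum
  matching \<open>M\<close>, the packing \<open>pm\<close> built from \<open>M\<close>, and outputs \<open>pa\<close>. If \<open>pg\<close> and \<open>pm\<close> have equal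
  length, either may be output.
\<close>

definition app_run ::
  "'i set \<Rightarrow> ('i \<Rightarrow> real) \<Rightarrow> ('i \<Rightarrow> real) \<Rightarrow> ('i \<Rightarrow> nat) \<Rightarrow> 'i set set \<Rightarrow> ('i \<Rightarrow> nat) \<Rightarrow> ('i \<Rightarrow> nat) \<Rightarrow> bool"
where
  "app_run S a b pg M pm pa \<longleftrightarrow>
     galo_packing S a b pg \<and>
     maximum_matching (chart_edges S a b) M \<and>
     matching_packing S a b M pm \<and>
     ((\<forall>i\<in>S. pa i = pg i) \<and> packing_length S pg \<le> packing_length S pm \<or>
      (\<forall>i\<in>S. pa i = pm i) \<and> packing_length S pm \<le> packing_length S pg)"


section \<open>Running time\<close>

text \<open>
  Running times refer to programs for a real random access machine, written in a while-language.
  The memory consists of named arrays of natural numbers and of reals; a scalar is cell \<open>0\<close> of an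
  array. Every arithmetic operation, comparison, Boolean operation, constant, memory access,
  assignment and branch costs at least one unit, so the cost bounds the number of arithmetic
  operations and comparisons on heights from above. Natural numbers support only addition,
  truncated subtraction and comparison, and reals cannot be converted to natural numbers
  (there is no rounding), so that unit costs are adequate.
\<close>

type_synonym vname = string

datatype nexp =
    NConst nat
  | NRead vname nexp
  | NPlus nexp nexp
  | NMinus nexp nexp

datatype rexp =
    RConst nat
  | RRead vname nexp
  | RPlus rexp rexp
  | RMinus rexp rexp
  | RTimes rexp rexp
  | RDivide rexp rexp

datatype bexp =
    NLe nexp nexp
  | RLe rexp rexp
  | BNot bexp
  | BAnd bexp bexp

datatype com =
    Skip
  | NAssign vname nexp nexp
  | RAssign vname nexp rexp
  | Seq com com
  | Branch bexp com com
  | While bexp com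

record store =
  nmem :: "vname \<Rightarrow> nat \<Rightarrow> nat"
  rmem :: "vname \<Rightarrow> nat \<Rightarrow> real"

fun nval :: "nexp \<Rightarrow> store \<Rightarrow> nat" where
  "nval (NConst c) s = c"
| "nval (NRead x e) s = nmem s x (nval e s)"
| "nval (NPlus e f) s = nval e s + nval f s"
| "nval (NMinus e f) s = nval e s - nval f s"

fun rval :: "rexp \<Rightarrow> store \<Rightarrow> real" where
  "rval (RConst c) s = real c"
| "rval (RRead x e) s = rmem s x (nval e s)"
| "rval (RPlus e f) s = rval e s + rval f s"
| "rval (RMinus e f) s = rval e s - rval f s"
| "rval (RTimes e f) s = rval e s * rval f s"
| "rval (RDivide e f) s = rval e s / rval f s"

fun bval :: "bexp \<Rightarrow> store \<Rightarrow> bool" where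
  "bval (NLe e f) s \<longleftrightarrow> nval e s \<le> nval f s"
| "bval (RLe e f) s \<longleftrightarrow> rval e s \<le> rval f s"
| "bval (BNot c) s \<longleftrightarrow> \<not> bval c s"
| "bval (BAnd c d) s \<longleftrightarrow> bval c s \<and> bval d s"

fun ncost :: "nexp \<Rightarrow> nat" where
  "ncost (NConst c) = 1"
| "ncost (NRead x e) = ncost e + 1"
| "ncost (NPlus e f) = ncost e + ncost f + 1"
| "ncost (NMinus e f) = ncost e + ncost f + 1"

fun rcost :: "rexp \<Rightarrow> nat" where
  "rcost (RConst c) = 1"
| "rcost (RRead x e) = ncost e + 1"
| "rcost (RPlus e f) = rcost e + rcost f + 1"
| "rcost (RMinus e f) = rcost e + rcost f + 1"
| "rcost (RTimes e f) = rcost e + rcost f + 1"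
| "rcost (RDivide e f) = rcost e + rcost f + 1"

fun bcost :: "bexp \<Rightarrow> nat" where
  "bcost (NLe e f) = ncost e + ncost f + 1"
| "bcost (RLe e f) = rcost e + rcost f + 1"
| "bcost (BNot c) = bcost c + 1"
| "bcost (BAnd c d) = bcost c + bcost d + 1"

definition nwrite :: "vname \<Rightarrow> nat \<Rightarrow> nat \<Rightarrow> store \<Rightarrow> store" where
  "nwrite x k v s = s\<lparr>nmem := (nmem s)(x := (nmem s x)(k := v))\<rparr>"

definition rwrite :: "vname \<Rightarrow> nat \<Rightarrow> real \<Rightarrow> store \<Rightarrow> store" where
  "rwrite x k v s = s\<lparr>rmem := (rmem s)(x := (rmem s x)(k := v))\<rparr>"

text \<open>\<open>exec c s t s'\<close>: program \<open>c\<close>, started in \<open>s\<close>, stops in \<open>s'\<close> at cost exactly \<open>t\<close>.\<close>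

inductive exec :: "com \<Rightarrow> store \<Rightarrow> nat \<Rightarrow> store \<Rightarrow> bool" where
  Skip: "exec Skip s 1 s"
| NAssign: "exec (NAssign x e f) s (ncost e + ncost f + 1) (nwrite x (nval e s) (nval f s) s)"
| RAssign: "exec (RAssign x e f) s (ncost e + rcost f + 1) (rwrite x (nval e s) (rval f s) s)"
| Seq: "\<lbrakk>exec c s t s'; exec d s' t' s''\<rbrakk> \<Longrightarrow> exec (Seq c d) s (t + t') s''"
| BranchTrue: "\<lbrakk>bval g s; exec c s t s'\<rbrakk> \<Longrightarrow> exec (Branch g c d) s (bcost g + 1 + t) s'"
| BranchFalse: "\<lbrakk>\<not> bval g s; exec d s t s'\<rbrakk> \<Longrightarrow> exec (Branch g c d) s (bcost g + 1 + t) s'"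
| WhileFalse: "\<not> bval g s \<Longrightarrow> exec (While g c) s (bcost g + 1) s"
| WhileTrue: "\<lbrakk>bval g s; exec c s t s'; exec (While g c) s' t' s''\<rbrakk>
    \<Longrightarrow> exec (While g c) s (bcost g + 1 + t + t') s''"

inductive_cases exec_SkipE: "exec Skip s t s'"
inductive_cases exec_NAssignE: "exec (NAssign x e f) s t s'"
inductive_cases exec_RAssignE: "exec (RAssign x e f) s t s'"
inductive_cases exec_SeqE: "exec (Seq c d) s t s'"
inductive_cases exec_BranchE: "exec (Branch g c d) s t s'"
inductive_cases exec_WhileE: "exec (While g c) s t s'"

lemma exec_deterministic:
  "exec c s t s' \<Longrightarrow> exec c s u s'' \<Longrightarrow> u = t \<and> s'' = s'"
proof (induction arbitrary: u s'' rule: exec.induct)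
  case (Skip s)
  from Skip.prems show ?case by (rule exec_SkipE) simp
next
  case (NAssign x e f s)
  from NAssign.prems show ?case by (rule exec_NAssignE) simp
next
  case (RAssign x e f s)
  from RAssign.prems show ?case by (rule exec_RAssignE) simp
next
  case (Seq c s t s' d t' r)
  from Seq.prems obtain v v' m where "u = v + v'" "exec c s v m" "exec d m v' s''"
    by (rule exec_SeqE)
  with Seq.IH(1)[of v m] Seq.IH(2)[of v' s''] show ?case by simp
next
  case (BranchTrue g s c t s' d)
  from BranchTrue.prems BranchTrue.hyps obtain v where "u = bcost g + 1 + v" "exec c s v s''"
    by (auto elim: exec_BranchE)
  with BranchTrue.IH[of v s''] show ?case by simp
next
  case (BranchFalse g s d t s' c)
  from BranchFalse.prems BranchFalse.hyps obtain v where "u = bcost g + 1 + v" "exec d s v s''"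
    by (auto elim: exec_BranchE)
  with BranchFalse.IH[of v s''] show ?case by simp
next
  case (WhileFalse g s c)
  from WhileFalse.prems show ?case
    by (rule exec_WhileE) (simp_all add: WhileFalse.hyps)
next
  case (WhileTrue g s c t s' t' r)
  from WhileTrue.prems obtain v v' m
    where "u = bcost g + 1 + v + v'" "exec c s v m" "exec (While g c) m v' s''"
    by (rule exec_WhileE) (simp_all add: WhileTrue.hyps)
  with WhileTrue.IH(1)[of v m] WhileTrue.IH(2)[of v' s''] show ?case by simp
qed

text \<open>Initially, all memory cells other than those holding the input are \<open>0\<close>.\<close>

definition input_store :: "nat \<Rightarrow> (nat \<Rightarrow> real) \<Rightarrow> (nat \<Rightarrow> real) \<Rightarrow> store" where
  "input_store n a b =
     \<lparr>nmem = (\<lambda>x k. if x = ''n'' \<and> k = 0 then n else 0),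
      rmem = (\<lambda>x k. if x = ''a'' \<and> k < n then a k else if x = ''b'' \<and> k < n then b k else 0)\<rparr>"

text \<open>A matching is stored as the array of mates; an unmatched vertex is its own mate.\<close>

definition edges_of_mates :: "nat \<Rightarrow> (nat \<Rightarrow> nat) \<Rightarrow> nat set set" where
  "edges_of_mates n m = {{i, m i} | i. i < n \<and> m i \<noteq> i}"

text \<open>
  On the charts \<open>0, \<dots>, n - 1\<close> with heights \<open>a\<close>, \<open>b\<close>, the program \<open>c\<close> performs an execution of
  App at cost at most \<open>t\<close>, leaving the intermediate results and the output packing in memory.
\<close>

definition performs_app :: "com \<Rightarrow> nat \<Rightarrow> (nat \<Rightarrow> real) \<Rightarrow> (nat \<Rightarrow> real) \<Rightarrow> nat \<Rightarrow> bool" where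
  "performs_app c n a b t \<longleftrightarrow>
     (\<exists>u s. exec c (input_store n a b) u s \<and> u \<le> t \<and>
        app_run {..<n} a b (nmem s ''pg'') (edges_of_mates n (nmem s ''mate''))
          (nmem s ''pm'') (nmem s ''pa''))"

end

theory Submission
  imports Defs
begin

text \<open>
  Let \<open>p\<close> be an optimal packing of \<open>n\<close> big charts, with \<open>s\<close> bins in which a chart starts and
  \<open>r\<close> maximal runs of used bins, so that \<open>OPT = s + r\<close>. No bin holds two big bars, hence
  \<open>n \<le> s + r\<close>, and at most two charts start in a bin. Bins with two starting charts give a
  matching, so the matching packing has length at most \<open>2 s\<close>. The charts of a run can be arranged in a
  sequence whose consecutive charts satisfy \<open>b i + a j \<le> 1\<close>. For every threshold \<open>\<theta>\<close>
  there are therefore at most \<open>r\<close> more charts with \<open>b i > 1 - \<theta>\<close> than charts with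
  \<open>a j < \<theta>\<close>. If \<open>\<theta>\<close> is the least first bar on the last of the \<open>c\<close> paths built
  by GALO, the excess is at least \<open>c - 1\<close>. So \<open>c \<le> r + 1\<close>, GALO has length
  \<open>n + c\<close>, and the smaller of \<open>2 s\<close> and \<open>n + r + 1\<close> is at most
  \<open>4/3 (s + r) + 2/3\<close>.

  For big charts the matching graph is bipartite: each edge joins a chart with \<open>a i > 1/2\<close> to one
  with \<open>a j \<le> 1/2\<close>. The charts of the first kind are treated in the order of decreasing
  \<open>a i\<close>, so the bound on \<open>a j\<close> only gets weaker, and giving each chart the free neighbour with
  the largest \<open>b j\<close> yields a maximum matching. A quadratic program thus suffices.
\<close>

section \<open>Packings of big charts\<close>

text \<open>The obstacle is that GALO starts one chart per bin, whereas an optimal packing may start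
  two, so the two packings cannot be compared bin by bin. Both are measured instead by one number:
  for a threshold \<theta>, the surplus of charts with \<open>b i > 1 - \<theta>\<close> over charts
  with \<open>a j < \<theta>\<close>. A chart of the first kind can only be followed by one of the
  second kind, so in any feasible packing each surplus chart costs the end of a run. GALO produces
  the surplus itself: a chart \<open>z\<close> with \<open>a z = \<theta>\<close> on its last path
  stays in the list while all earlier paths are built, so every chart that ends an earlier path, or
  is followed by a chart with a first bar below \<theta>, had no room for \<open>z\<close> and
  satisfies \<open>b i > 1 - \<theta>\<close>.

  Bigness makes the charts of a run a sequence. Two charts that start in one bin have their big bars
  on opposite sides, which leaves the second bar of one and the first bar of the other at most 1/2.

  In the matching program bigness also removes the need for augmenting paths: in each round a
  maximum pairing of the free charts can be rearranged to contain the chosen pair.\<close>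

lemma sum_ge_two:
  fixes f :: "'i \<Rightarrow> real"
  assumes "finite A" "i \<in> A" "j \<in> A" "i \<noteq> j" "\<And>x. x \<in> A \<Longrightarrow> 0 \<le> f x"
  shows "f i + f j \<le> sum f A"
proof -
  have "sum f {i, j} \<le> sum f A"
    using assms by (intro sum_mono2) auto
  then show ?thesis using assms(4) by simp
qed

lemma feasible_same_bin:
  assumes "two_bar_charts S a b" "feasible S a b p" "i \<in> S" "j \<in> S" "i \<noteq> j" "p i = p j"
  shows "a i + a j \<le> 1" "b i + b j \<le> 1"
proof -
  have fin: "finite S" and pos: "\<And>x. x \<in> S \<Longrightarrow> 0 \<le> a x" "\<And>x. x \<in> S \<Longrightarrow> 0 \<le> b x"
    using assms(1) by (force simp: two_bar_charts_def)+
  have pi: "p i \<in> {1..2 * card S - 1}"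
    using assms(2,3) by (auto simp: feasible_def)
  have bin: "(\<Sum>i\<in>starts_in S p k. a i) + (\<Sum>i\<in>starts_in S p (k - 1). b i) \<le> 1"
    if "k \<in> {1..2 * card S}" for k
    using assms(2) that by (auto simp: feasible_def)
  have nn: "0 \<le> (\<Sum>i\<in>starts_in S p k. a i)" "0 \<le> (\<Sum>i\<in>starts_in S p k. b i)" for k
    using pos by (auto simp: starts_in_def intro: sum_nonneg)
  have mem: "i \<in> starts_in S p (p i)" "j \<in> starts_in S p (p i)" "finite (starts_in S p (p i))"
    using assms fin by (auto simp: starts_in_def)
  have "a i + a j \<le> (\<Sum>i\<in>starts_in S p (p i). a i)"
    using mem assms pos by (intro sum_ge_two) (auto simp: starts_in_def)
  then show "a i + a j \<le> 1"
    using bin[of "p i"] nn(2)[of "p i - 1"] pi by force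
  have "b i + b j \<le> (\<Sum>i\<in>starts_in S p (p i). b i)"
    using mem assms pos by (intro sum_ge_two) (auto simp: starts_in_def)
  then show "b i + b j \<le> 1"
    using bin[of "Suc (p i)"] nn(1)[of "Suc (p i)"] pi by force
qed

lemma feasible_next_bin:
  assumes "two_bar_charts S a b" "feasible S a b p" "i \<in> S" "j \<in> S" "p j = Suc (p i)"
  shows "b i + a j \<le> 1"
proof -
  have fin: "finite S" and pos: "\<And>x. x \<in> S \<Longrightarrow> 0 \<le> a x" "\<And>x. x \<in> S \<Longrightarrow> 0 \<le> b x"
    using assms(1) by (force simp: two_bar_charts_def)+
  have pj: "p j \<in> {1..2 * card S - 1}"
    using assms(2,4) by (auto simp: feasible_def)
  have "(\<Sum>i\<in>starts_in S p (p j). a i) + (\<Sum>i\<in>starts_in S p (p j - 1). b i) \<le> 1"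
    using assms(2) pj by (auto simp: feasible_def)
  moreover have "a j \<le> (\<Sum>i\<in>starts_in S p (p j). a i)"
    using fin pos assms by (intro member_le_sum) (auto simp: starts_in_def)
  moreover have "b i \<le> (\<Sum>i\<in>starts_in S p (p j - 1). b i)"
    using fin pos assms by (intro member_le_sum) (auto simp: starts_in_def)
  ultimately show ?thesis by linarith
qed

section \<open>Length as the number of start bins plus the number of run ends\<close>

lemma packing_length_image:
  assumes "p \<in> S \<rightarrow> {1..2 * card S - 1}"
  shows "packing_length S p = card (p ` S \<union> Suc ` p ` S)"
proof -
  have "{k \<in> {1..2 * card S}. \<exists>i\<in>S. p i = k \<or> p i + 1 = k} = p ` S \<union> Suc ` p ` S"
    using assms by (fastforce simp: Pi_iff)
  then show ?thesis by (simp add: packing_length_def)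
qed

text \<open>The bins that follow a start bin without being one are exactly the last bins of the
  maximal runs, so the second summand is the number of runs. For GALO it is the number of
  paths.\<close>

lemma packing_length_run_ends:
  assumes "finite S" "p \<in> S \<rightarrow> {1..2 * card S - 1}"
  shows "packing_length S p = card (p ` S) + card (Suc ` p ` S - p ` S)"
proof -
  have "p ` S \<union> Suc ` p ` S = p ` S \<union> (Suc ` p ` S - p ` S)" by auto
  then show ?thesis
    using assms card_Un_disjoint[of "p ` S" "Suc ` p ` S - p ` S"]
    by (simp add: packing_length_image Int_Diff)
qed

lemma packing_length_le_double:
  assumes "finite S" "p \<in> S \<rightarrow> {1..2 * card S - 1}"
  shows "packing_length S p \<le> 2 * card (p ` S)"
proof -
  have "card (Suc ` p ` S - p ` S) \<le> card (Suc ` p ` S)"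
    using assms(1) by (intro card_mono) auto
  also have "\<dots> \<le> card (p ` S)" using assms(1) by (intro card_image_le) auto
  finally show ?thesis using packing_length_run_ends[OF assms] by simp
qed

lemma card_le_packing_length:
  assumes "two_bar_charts S a b" "\<forall>i\<in>S. big a b i" "feasible S a b p"
  shows "card S \<le> packing_length S p"
proof -
  \<comment> \<open>a bin can hold only one big bar\<close>
  define g where "g i = (if a i > 1/2 then p i else Suc (p i))" for i
  have "inj_on g S"
  proof (rule inj_onI, rule ccontr)
    fix i j assume ij: "i \<in> S" "j \<in> S" "g i = g j" "i \<noteq> j"
    have "p i = p j \<Longrightarrow> a i + a j \<le> 1 \<and> b i + b j \<le> 1"
      "p j = Suc (p i) \<Longrightarrow> b i + a j \<le> 1" "p i = Suc (p j) \<Longrightarrow> b j + a i \<le> 1"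
      using feasible_same_bin[OF assms(1,3), of i j] feasible_next_bin[OF assms(1,3), of i j]
        feasible_next_bin[OF assms(1,3), of j i] ij by auto
    moreover have "a i > 1/2 \<or> b i > 1/2" "a j > 1/2 \<or> b j > 1/2"
      using assms(2) ij by (auto simp: big_def)
    ultimately show False using ij(3) by (auto simp: g_def split: if_splits)
  qed
  then have "card S = card (g ` S)" by (simp add: card_image)
  also have "\<dots> \<le> card (p ` S \<union> Suc ` p ` S)"
    using assms(1) by (intro card_mono) (auto simp: g_def two_bar_charts_def)
  finally show ?thesis
    using assms(3) by (simp add: packing_length_image feasible_def)
qed

lemma OPT_le_packing_length:
  "feasible S a b p \<Longrightarrow> OPT S a b \<le> packing_length S p"
  unfolding OPT_def by (rule Least_le) blast

lemma OPT_attained: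
  assumes "feasible S a b q"
  obtains p where "feasible S a b p" "packing_length S p = OPT S a b"
proof -
  have "\<exists>p. feasible S a b p \<and> packing_length S p = OPT S a b"
    unfolding OPT_def by (rule LeastI) (use assms in blast)
  then show ?thesis using that by blast
qed

text \<open>Two of three big charts have their big bar on the same side, and these two overfill a
  bin.\<close>

lemma three_big_in_bin:
  assumes "two_bar_charts S a b" "\<forall>i\<in>S. big a b i" "feasible S a b p"
    "u \<in> S" "v \<in> S" "w \<in> S" "p u = p v" "p v = p w"
  shows "u = v \<or> v = w \<or> u = w"
proof (rule ccontr)
  note F = feasible_same_bin[OF assms(1,3)]
  assume "\<not> ?thesis"
  then have "a u + a v \<le> 1" "b u + b v \<le> 1" "a v + a w \<le> 1" "b v + b w \<le> 1"
    "a u + a w \<le> 1" "b u + b w \<le> 1"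
    using F[of u v] F[of v w] F[of u w] assms by auto
  moreover have "a u > 1/2 \<or> b u > 1/2" "a v > 1/2 \<or> b v > 1/2" "a w > 1/2 \<or> b w > 1/2"
    using assms(2,4-6) by (auto simp: big_def)
  ultimately show False by (elim disjE) linarith+
qed

text \<open>Every start bin accounts for one chart, and a bin accounts for a second one only if it
  yields an edge. These edges are disjoint, so there are at most \<open>card M\<close> of
  them.\<close>

lemma card_le_starts_plus_matching:
  assumes ch: "two_bar_charts S a b" and big: "\<forall>i\<in>S. big a b i" and fe: "feasible S a b p"
    and mm: "maximum_matching (chart_edges S a b) M"
  shows "card S \<le> card (p ` S) + card M"
proof -
  have fin: "finite S" using ch by (simp add: two_bar_charts_def)
  define D where "D = {k \<in> p ` S. card (starts_in S p k) = 2}"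
  have c2: "card (starts_in S p k) \<le> 2" for k
  proof (rule ccontr)
    assume "\<not> ?thesis"
    then have "3 \<le> card (starts_in S p k)" by simp
    then obtain T where T: "T \<subseteq> starts_in S p k" "card T = 3"
      by (meson obtain_subset_with_card_n)
    then obtain u v w where "T = {u, v, w}" "u \<noteq> v" "v \<noteq> w" "u \<noteq> w"
      by (auto simp: card_3_iff)
    then show False
      using three_big_in_bin[OF ch big fe, of u v w] T by (auto simp: starts_in_def)
  qed
  have inj: "inj_on (starts_in S p) D"
    by (rule inj_onI) (auto simp: D_def starts_in_def)
  have "starts_in S p ` D \<subseteq> chart_edges S a b"
  proof
    fix e assume "e \<in> starts_in S p ` D"
    then obtain k where k: "e = starts_in S p k" "card e = 2" by (auto simp: D_def)
    then obtain i j where "e = {i, j}" "i \<noteq> j" by (auto simp: card_2_iff)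
    moreover from this have "i \<in> starts_in S p k" "j \<in> starts_in S p k" using k by auto
    then have "i \<in> S" "j \<in> S" "p i = p j" by (auto simp: starts_in_def)
    ultimately show "e \<in> chart_edges S a b"
      using feasible_same_bin[OF ch fe, of i j] by (auto simp: chart_edges_def)
  qed
  moreover have "pairwise disjnt (starts_in S p ` D)"
    by (auto simp: pairwise_def disjnt_def starts_in_def)
  ultimately have "card (starts_in S p ` D) \<le> card M"
    using mm by (auto simp: maximum_matching_def matching_def)
  then have D: "card D \<le> card M" by (simp add: card_image inj)
  have "card S = (\<Sum>k\<in>p ` S. card (starts_in S p k))"
    unfolding starts_in_def by (subst card_eq_sum, subst sum.image_gen[OF fin, of _ p]) simp
  also have "\<dots> \<le> (\<Sum>k\<in>p ` S. 1 + (if k \<in> D then 1 else 0))"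
  proof (rule sum_mono)
    fix k assume "k \<in> p ` S"
    then show "card (starts_in S p k) \<le> 1 + (if k \<in> D then 1 else 0)"
      using c2[of k] by (auto simp: D_def)
  qed
  also have "\<dots> = card (p ` S) + card D"
  proof -
    have "D \<subseteq> p ` S" by (auto simp: D_def)
    then have "p ` S \<inter> D = D" by blast
    then show ?thesis
      unfolding sum.distrib using fin by (simp flip: sum.inter_restrict)
  qed
  finally show ?thesis using D by simp
qed

text \<open>Dropping one representative \<open>r e\<close> of every edge loses no start bin, because
  the partner starts in the same bin. Each remaining start bin contributes at most two used bins,
  wherever the unmatched charts are placed.\<close>

lemma matching_packing_length:
  assumes fin: "finite S" and mp: "matching_packing S a b M p"
    and ma: "matching (chart_edges S a b) M"
  shows "packing_length S p + 2 * card M \<le> 2 * card S"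
proof -
  define r where "r e = (SOME i. i \<in> e)" for e :: "'a set"
  have e: "\<exists>i j. e = {i, j} \<and> i \<in> S \<and> j \<in> S \<and> i \<noteq> j \<and> p i = p j" if "e \<in> M" for e
  proof -
    have "e \<in> chart_edges S a b" using that ma by (auto simp: matching_def)
    then obtain i j where ij: "e = {i, j}" "i \<in> S" "j \<in> S" "i \<noteq> j"
      by (auto simp: chart_edges_def)
    then show ?thesis using mp that unfolding matching_packing_def by blast
  qed
  have r: "r e \<in> e" if "e \<in> M" for e
    using e[OF that] unfolding r_def by (metis insertI1 someI_ex)
  have "pairwise disjnt M" using ma by (simp add: matching_def)
  then have uniq: "f = g" if "f \<in> M" "g \<in> M" "x \<in> f" "x \<in> g" for f g x
    using that by (auto simp: pairwise_def disjnt_iff)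
  have inj: "inj_on r M"
    by (rule inj_onI) (metis r uniq)
  have sub: "r ` M \<subseteq> S" 
  proof
    fix x assume "x \<in> r ` M"
    then obtain f where "f \<in> M" "x = r f" by auto
    with e[of f] r[of f] show "x \<in> S" by auto
  qed
  have "p ` S \<subseteq> p ` (S - r ` M)"
  proof
    fix k assume "k \<in> p ` S"
    then obtain i where i: "i \<in> S" "k = p i" by auto
    show "k \<in> p ` (S - r ` M)"
    proof (cases "i \<in> r ` M")
      case True
      then obtain f where f: "f \<in> M" "i = r f" by auto
      from e[OF f(1)] obtain x y where
        xy: "f = {x, y}" "x \<in> S" "y \<in> S" "x \<noteq> y" "p x = p y" by blast
      define j where "j = (if i = x then y else x)"
      have j: "j \<in> f" "j \<noteq> i" "j \<in> S" "p j = p i"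
        using xy r[OF f(1)] f(2) by (auto simp: j_def)
      \<comment> \<open>By disjointness \<open>f\<close> is the only edge that contains
        \<open>j\<close>, and its representative is \<open>i\<close>.\<close>
      have "j \<notin> r ` M"
      proof
        assume "j \<in> r ` M"
        then obtain f' where "f' \<in> M" "j = r f'" by auto
        with r[of f'] f j uniq[of f f' j] show False by auto
      qed
      then show ?thesis using i j by (intro image_eqI[of _ _ j]) auto
    qed (use i in auto)
  qed
  then have "card (p ` S) \<le> card (p ` (S - r ` M))"
    using fin by (intro card_mono) auto
  also have "\<dots> \<le> card (S - r ` M)" using fin by (intro card_image_le) auto
  also have "\<dots> = card S - card M"
    using fin sub by (simp add: card_Diff_subset finite_subset card_image inj)
  finally have "card (p ` S) \<le> card S - card M" .
  moreover have "card M \<le> card S"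
    using card_mono[OF fin sub] by (simp add: card_image inj)
  moreover have "packing_length S p \<le> 2 * card (p ` S)"
    using mp fin by (intro packing_length_le_double) (auto simp: matching_packing_def feasible_def)
  ultimately show ?thesis by simp
qed

text \<open>An injection \<open>f\<close> sends each chart to its successor in the run, or to the
  closing bin of the run if it comes last. If \<open>b i > 1 - th\<close>, then a successor of
  \<open>i\<close> has first bar below \<open>th\<close>.\<close>

lemma run_ends_lower_bound:
  fixes th :: real
  assumes ch: "two_bar_charts S a b" and big: "\<forall>i\<in>S. big a b i" and fe: "feasible S a b p"
  shows "card {i\<in>S. b i > 1 - th} \<le> card {j\<in>S. a j < th} + card (Suc ` p ` S - p ` S)"
proof -
  have fin: "finite S" using ch by (simp add: two_bar_charts_def)
  note same = feasible_same_bin[OF ch fe] and nxt = feasible_next_bin[OF ch fe]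
  note three = three_big_in_bin[OF ch big fe]
  \<comment> \<open>Inside a bin the chart with the big first bar comes first. In the resulting order
    consecutive charts of a run satisfy \<open>b i + a j \<le> 1\<close>.\<close>
  define fst_in where "fst_in i \<longleftrightarrow> (\<forall>j\<in>S. j \<noteq> i \<longrightarrow> p j = p i \<longrightarrow> a i > 1/2)" for i
  define lst_in where "lst_in i \<longleftrightarrow> (\<forall>j\<in>S. j \<noteq> i \<longrightarrow> p j = p i \<longrightarrow> a j > 1/2)" for i
  \<comment> \<open>Big bars on the same side would overfill a bin, so exactly one of the two charts
    has a big first bar, and its second bar is small. With this chart placed first, the bars that
    meet are both at most 1/2.\<close>
  have ord: "a i > 1/2 \<and> b i \<le> 1/2 \<and> a j \<le> 1/2 \<and> b j > 1/2 \<or>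
      a j > 1/2 \<and> b j \<le> 1/2 \<and> a i \<le> 1/2 \<and> b i > 1/2"
    if "i \<in> S" "j \<in> S" "i \<noteq> j" "p i = p j" for i j
  proof -
    have "a i + a j \<le> 1" "b i + b j \<le> 1" using same that by auto
    moreover have "a i > 1/2 \<or> b i > 1/2" "a j > 1/2 \<or> b j > 1/2"
      using big that by (auto simp: big_def)
    ultimately show ?thesis by (elim disjE) linarith+
  qed
  have ex_fst: "\<exists>j\<in>S. p j = k \<and> fst_in j" if k: "k \<in> p ` S" for k
  proof -
    obtain i where i: "i \<in> S" "p i = k" using k by auto
    show ?thesis
    proof (cases "fst_in i")
      case False
      then obtain j where "j \<in> S" "j \<noteq> i" "p j = p i" "\<not> a i > 1/2" by (auto simp: fst_in_def)
      moreover from this ord[of i j] i have "a j > 1/2" by auto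
      ultimately show ?thesis using i by (intro bexI[of _ j]) (auto simp: fst_in_def)
    qed (use i in auto)
  qed
  have ex_lst: "\<exists>j\<in>S. j \<noteq> i \<and> p j = p i \<and> \<not> fst_in j \<and> a j \<le> 1/2 \<and> b i \<le> 1/2"
    if i: "i \<in> S" "\<not> lst_in i" for i
  proof -
    obtain j where "j \<in> S" "j \<noteq> i" "p j = p i" "\<not> a j > 1/2"
      using i by (auto simp: lst_in_def)
    moreover from this ord[of i j] i have "b i \<le> 1/2" "a j \<le> 1/2" by auto
    ultimately show ?thesis using i by (intro bexI[of _ j]) (auto simp: fst_in_def)
  qed
  have lst_unique: "i = j" if "i \<in> S" "j \<in> S" "p i = p j" "lst_in i" "lst_in j" for i j
  proof (rule ccontr)
    assume "i \<noteq> j"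
    with that have "a j > 1/2" "a i > 1/2" by (auto simp: lst_in_def)
    with ord[of i j] that \<open>i \<noteq> j\<close> show False by auto
  qed
  define g where "g i = (SOME j. j \<in> S \<and> j \<noteq> i \<and> p j = p i \<and> \<not> fst_in j \<and> a j \<le> 1/2 \<and> b i \<le> 1/2)" for i
  have g: "g i \<in> S \<and> g i \<noteq> i \<and> p (g i) = p i \<and> \<not> fst_in (g i) \<and> a (g i) \<le> 1/2 \<and> b i \<le> 1/2"
    if "i \<in> S" "\<not> lst_in i" for i
    using someI_ex[OF ex_lst[OF that, unfolded Bex_def]] unfolding g_def .
  define h where "h k = (SOME j. j \<in> S \<and> p j = k \<and> fst_in j)" for k
  have h: "h k \<in> S \<and> p (h k) = k \<and> fst_in (h k)" if "k \<in> p ` S" for k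
    using someI_ex[OF ex_fst[OF that, unfolded Bex_def]] unfolding h_def .
  \<comment> \<open>\<open>Inl\<close> holds the next chart, in the same bin or the next one.
    \<open>Inr\<close> holds the bin that closes the run.\<close>
  define f :: "'a \<Rightarrow> 'a + nat" where "f i = (if \<not> lst_in i then Inl (g i)
     else if Suc (p i) \<in> p ` S then Inl (h (Suc (p i))) else Inr (Suc (p i)))" for i
  have "inj_on f S"
  proof (rule inj_onI)
    fix i i' assume ii: "i \<in> S" "i' \<in> S" "f i = f i'"
    show "i = i'"
    proof (cases "lst_in i"; cases "lst_in i'")
      assume l: "lst_in i" "lst_in i'"
      have "Suc (p i) = Suc (p i')"
      proof (cases "Suc (p i) \<in> p ` S"; cases "Suc (p i') \<in> p ` S")
        assume m: "Suc (p i) \<in> p ` S" "Suc (p i') \<in> p ` S"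
        then have "p (h (Suc (p i))) = p (h (Suc (p i')))"
          using ii(3) l unfolding f_def by simp
        then show ?thesis using h[OF m(1)] h[OF m(2)] by argo
      qed (use ii(3) l in \<open>simp_all add: f_def\<close>)
      then show ?thesis using lst_unique ii(1,2) l by simp
    next
      assume l: "\<not> lst_in i" "\<not> lst_in i'"
      then have "g i = g i'" using ii(3) unfolding f_def by simp
      moreover note g1 = g[OF ii(1) l(1)] and g2 = g[OF ii(2) l(2)]
      ultimately have gi: "p i = p (g i)" "p (g i) = p i'" "g i \<noteq> i" "g i \<noteq> i'" by simp_all
      \<comment> \<open>The charts \<open>i\<close>, \<open>i'\<close> and their common successor
        start in one bin, which has room for only two big charts.\<close>
      have "i = g i \<or> g i = i' \<or> i = i'"
        using three[OF ii(1) _ ii(2) gi(1,2)] g1 by blast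
      then show ?thesis using gi(3,4) by (elim disjE) simp_all
    next
      assume l: "lst_in i" "\<not> lst_in i'"
      have "fst_in (g i')"
        using ii(3) l h[of "Suc (p i)"] unfolding f_def by (auto split: if_split_asm)
      then show ?thesis using g[OF ii(2) l(2)] by blast
    next
      assume l: "\<not> lst_in i" "lst_in i'"
      have "fst_in (g i)"
        using ii(3) l h[of "Suc (p i')"] unfolding f_def by (auto split: if_split_asm)
      then show ?thesis using g[OF ii(1) l(1)] by blast
    qed
  qed
  then have "card {i\<in>S. b i > 1 - th} = card (f ` {i\<in>S. b i > 1 - th})"
    by (intro card_image[symmetric]) (auto simp: inj_on_def)
  also have "\<dots> \<le> card (Inl ` {j\<in>S. a j < th} \<union> Inr ` (Suc ` p ` S - p ` S) :: ('a + nat) set)"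
  proof (rule card_mono)
    show "f ` {i\<in>S. b i > 1 - th} \<subseteq> Inl ` {j\<in>S. a j < th} \<union> Inr ` (Suc ` p ` S - p ` S)"
    proof
      fix x assume "x \<in> f ` {i\<in>S. b i > 1 - th}"
      then obtain i where i: "x = f i" "i \<in> S" "b i > 1 - th" by auto
      consider "\<not> lst_in i" | "lst_in i" "Suc (p i) \<in> p ` S" | "lst_in i" "Suc (p i) \<notin> p ` S"
        by blast
      then show "x \<in> Inl ` {j\<in>S. a j < th} \<union> Inr ` (Suc ` p ` S - p ` S)"
      proof cases
        case 1
        \<comment> \<open>Here \<open>th > 1 - b i \<ge> 1/2 \<ge> a (g i)\<close>, both bars being
          small.\<close>
        then show ?thesis using g[OF i(2)] i by (intro UnI1) (auto simp: f_def)
      next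
        case 2
        then have "b i + a (h (Suc (p i))) \<le> 1" using nxt[OF i(2)] h by simp
        then show ?thesis using 2 h[OF 2(2)] i by (intro UnI1) (auto simp: f_def)
      next
        case 3
        then show ?thesis using i by (intro UnI2) (simp add: f_def)
      qed
    qed
  qed (use fin in auto)
  also have "\<dots> = card {j\<in>S. a j < th} + card (Suc ` p ` S - p ` S)"
  proof -
    have "Inl ` {j\<in>S. a j < th} \<inter> Inr ` (Suc ` p ` S - p ` S) = ({} :: ('a + nat) set)" by blast
    then show ?thesis using fin by (subst card_Un_disjoint) (simp_all add: card_image)
  qed
  finally show ?thesis .
qed

section \<open>GALO packings\<close>

lemma galo_find_Some:
  assumes "find (fits_after a b prev) ys = Some y"
  shows "galo a b k prev ys = (galo a b (Suc k) (Some y) (remove1 y ys))(y := k)"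
  using assms by (cases ys) auto

lemma galo_find_None:
  assumes "find (fits_after a b prev) ys = None"
  shows "galo a b k prev ys = galo a b (Suc k) None ys"
  using assms by (cases ys) auto

lemma find_Some_in_set: "find P xs = Some y \<Longrightarrow> y \<in> set xs \<and> P y"
  by (auto simp: find_Some_iff)

lemma find_Some_first:
  assumes "find P xs = Some y" "sorted_wrt R xs" "z \<in> set xs" "P z"
  shows "z = y \<or> R y z"
proof -
  obtain i where i: "i < length xs" "y = xs ! i" "\<forall>j<i. \<not> P (xs ! j)"
    using assms(1) by (auto simp: find_Some_iff)
  obtain j where j: "j < length xs" "z = xs ! j" using assms(3) by (auto simp: in_set_conv_nth)
  have "i \<le> j" using i j assms(4) by (meson not_le_imp_less)
  then show ?thesis
    using i j assms(2) by (cases "i = j") (auto simp: sorted_wrt_iff_nth_less)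
qed

lemma sorted_wrt_remove1: "sorted_wrt R xs \<Longrightarrow> sorted_wrt R (remove1 x xs)"
  by (induction xs) (auto dest: subsetD[OF set_remove1_subset])

text \<open>A bin is skipped only right after a chart was placed, since every chart fits when there
  is no predecessor. This is why \<open>Skip\<close> speaks of \<open>Some x\<close> only. The
  relation \<open>R\<close> is left open: facts that do not depend on the order take the trivial
  one.\<close>

lemma galo_induct [consumes 2, case_names Nil Skip Place]:
  assumes "distinct ys" "sorted_wrt R ys"
  assumes "\<And>k prev. P k prev []"
  assumes "\<And>k x ys. ys \<noteq> [] \<Longrightarrow> distinct ys \<Longrightarrow> sorted_wrt R ys \<Longrightarrow>
     find (fits_after a b (Some x)) ys = None \<Longrightarrow> P (Suc k) None ys \<Longrightarrow> P k (Some x) ys"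
  assumes "\<And>k prev ys y. distinct ys \<Longrightarrow> sorted_wrt R ys \<Longrightarrow>
     find (fits_after a b prev) ys = Some y \<Longrightarrow> P (Suc k) (Some y) (remove1 y ys) \<Longrightarrow> P k prev ys"
  shows "P k prev ys"
  using assms(1,2)
proof (induction "2 * length ys + (if prev = None then 0 else 1)" arbitrary: k prev ys
    rule: less_induct)
  case less
  show ?case
  proof (cases "find (fits_after a b prev) ys")
    case (Some y)
    have "P (Suc k) (Some y) (remove1 y ys)"
      using find_Some_length_remove1[OF Some] less.prems
      by (intro less.hyps) (auto simp: sorted_wrt_remove1 split: if_splits)
    then show ?thesis using assms(5) Some less.prems by blast
  next
    case None
    show ?thesis
    proof (cases "ys = []")
      case False
      then obtain x where x: "prev = Some x" using None by (cases prev; cases ys) auto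
      have "P (Suc k) None ys" using x less.prems by (intro less.hyps) auto
      then show ?thesis using assms(4) None less.prems False x by blast
    qed (simp add: assms(3))
  qed
qed


text \<open>A chart uses up at most two bins, its own and a skipped one before it. Without a
  predecessor no bin is skipped before the first chart, which saves one. From \<open>k = 1\<close>
  and \<open>None\<close> this gives the largest admissible start
  \<open>2 * length ys - 1\<close>.\<close>

lemma galo_range:
  assumes "distinct ys"
  shows "\<forall>y\<in>set ys. k \<le> galo a b k prev ys y \<and>
    galo a b k prev ys y + (if prev = None then 2 else 1) \<le> k + 2 * length ys"
proof -
  have "sorted_wrt (\<lambda>_ _. True) ys" by (simp add: sorted_wrt_iff_nth_less)
  with assms show ?thesis
  proof (induction k prev ys rule: galo_induct[where a = a and b = b])
    case (Skip k x ys)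
    then show ?case by (force simp: galo_find_None)
  next
    case (Place k prev ys y)
    have y: "y \<in> set ys" using find_Some_in_set[OF Place(3)] by simp
    then have "length ys > 0" by (cases ys) auto
    moreover have "length (remove1 y ys) = length ys - 1" using y by (simp add: length_remove1)
    ultimately have "length ys = Suc (length (remove1 y ys))" by simp
    then have len: "Suc k + 2 * length (remove1 y ys) + 1 = k + 2 * length ys" by simp
    show ?case
    proof
      fix x assume x: "x \<in> set ys"
      show "k \<le> galo a b k prev ys x \<and>
        galo a b k prev ys x + (if prev = None then 2 else 1) \<le> k + 2 * length ys"
      proof (cases "x = y")
        case True
        then show ?thesis
          using len by (simp add: galo_find_Some[OF Place(3)])
      next
        case False
        then have "x \<in> set (remove1 y ys)" using x Place(1) by simp
        with Place.IH have "Suc k \<le> galo a b (Suc k) (Some y) (remove1 y ys) x \<and>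
          galo a b (Suc k) (Some y) (remove1 y ys) x + 1 \<le> Suc k + 2 * length (remove1 y ys)"
          by simp
        then show ?thesis using False len by (simp add: galo_find_Some[OF Place(3)])
      qed
    qed
  qed simp
qed

lemma inj_on_galo:
  assumes "distinct ys"
  shows "inj_on (galo a b k prev ys) (set ys)"
proof -
  have "sorted_wrt (\<lambda>_ _. True) ys" by (simp add: sorted_wrt_iff_nth_less)
  with assms show ?thesis
  proof (induction k prev ys rule: galo_induct[where a = a and b = b])
    case (Place k prev ys y)
    have "Suc k \<le> galo a b (Suc k) (Some y) (remove1 y ys) x" if "x \<in> set ys" "x \<noteq> y" for x
      using galo_range[of "remove1 y ys" "Suc k" a b "Some y"] that Place(1) by auto
    with Place.IH Place(1) show ?case
      by (force simp: galo_find_Some[OF Place(3)] inj_on_def)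
  qed (auto simp: galo_find_None)
qed

lemma galo_step:
  assumes "distinct ys" "find (fits_after a b prev) ys = Some y"
  shows "galo a b k prev ys y = k"
    and "x \<in> set ys \<Longrightarrow> x \<noteq> y \<Longrightarrow> Suc k \<le> galo a b k prev ys x"
    and "x \<noteq> y \<Longrightarrow> galo a b (Suc k) (Some y) (remove1 y ys) x = galo a b k prev ys x"
    and "set (remove1 y ys) = set ys - {y}" and "y \<in> set ys"
  using assms galo_range[of "remove1 y ys" "Suc k" a b "Some y"] find_Some_in_set[OF assms(2)]
  by (auto simp: galo_find_Some[OF assms(2)])

text \<open>The second conjunct is the interface to the chart already placed in bin
  \<open>k - 1\<close>. The induction needs it, and it is vacuous at the start of the
  algorithm.\<close>

lemma galo_fits:
  assumes "distinct ys"
  shows "(\<forall>x\<in>set ys. \<forall>y\<in>set ys.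
       galo a b k prev ys y = Suc (galo a b k prev ys x) \<longrightarrow> b x + a y \<le> 1) \<and>
     (\<forall>x. \<forall>y\<in>set ys. prev = Some x \<and> galo a b k prev ys y = k \<longrightarrow> b x + a y \<le> 1)"
proof -
  have "sorted_wrt (\<lambda>_ _. True) ys" by (simp add: sorted_wrt_iff_nth_less)
  with assms show ?thesis
  proof (induction k prev ys rule: galo_induct[where a = a and b = b])
    case (Skip k x ys)
    have "Suc k \<le> galo a b (Suc k) None ys y" if "y \<in> set ys" for y
      using galo_range[of ys "Suc k" a b None] that Skip(2) by auto
    then show ?case using Skip.IH by (fastforce simp: galo_find_None[OF Skip(4)])
  next
    case (Place k prev ys y)
    note st = galo_step(1-3)[OF Place(1,3), where k = k] galo_step(4,5)[OF Place(1,3)]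
    let ?q = "galo a b k prev ys"
    have fit: "fits_after a b prev y" using find_Some_in_set[OF Place(3)] by simp
    have IH1: "b u + a v \<le> 1" if "u \<in> set ys" "v \<in> set ys" "u \<noteq> y" "v \<noteq> y" "?q v = Suc (?q u)" for u v
      using Place.IH that st by auto
    have IH2: "b y + a v \<le> 1" if "v \<in> set ys" "v \<noteq> y" "?q v = Suc k" for v
      using Place.IH that st by auto
    have "b u + a v \<le> 1" if "u \<in> set ys" "v \<in> set ys" "?q v = Suc (?q u)" for u v
      using IH1[OF that(1,2)] IH2[OF that(2)] that st(1) st(2)[of u] by (cases "u = y"; cases "v = y") auto
    moreover have "b u + a v \<le> 1" if "prev = Some u" "v \<in> set ys" "?q v = k" for u v
      using that fit st(2)[of v] by (cases "v = y") auto
    ultimately show ?case by blast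
  qed simp
qed

text \<open>A chart \<open>z\<close> that is packed later was still in the list when an earlier bin
  was processed. If it fitted there, the chart that was taken stands no later in the list and so has
  at least as large a first bar. The first two conjuncts apply this after a chart of
  \<open>ys\<close> and after \<open>prev\<close>. The third applies it to path heads, where
  everything fits. A chart in bin \<open>k\<close> after some \<open>prev\<close> continues a path
  and has to be excluded as a head, although no chart of \<open>ys\<close> precedes it.\<close>

lemma galo_greedy:
  assumes "distinct ys" "sorted_wrt (\<lambda>x y. a y \<le> a x) ys"
  shows "(\<forall>x\<in>set ys. \<forall>z\<in>set ys.
       Suc (galo a b k prev ys x) < galo a b k prev ys z \<and> b x + a z \<le> 1 \<longrightarrow>
       (\<exists>y\<in>set ys. galo a b k prev ys y = Suc (galo a b k prev ys x) \<and> a z \<le> a y)) \<and>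
     (\<forall>x. \<forall>z\<in>set ys. prev = Some x \<and> k < galo a b k prev ys z \<and> b x + a z \<le> 1 \<longrightarrow>
       (\<exists>y\<in>set ys. galo a b k prev ys y = k \<and> a z \<le> a y)) \<and>
     (\<forall>y\<in>set ys. \<forall>z\<in>set ys. galo a b k prev ys y < galo a b k prev ys z \<and>
       (prev = None \<or> galo a b k prev ys y \<noteq> k) \<and>
       (\<forall>x\<in>set ys. galo a b k prev ys y \<noteq> Suc (galo a b k prev ys x)) \<longrightarrow> a z \<le> a y)"
  using assms
proof (induction k prev ys rule: galo_induct[where a = a and b = b])
  case (Skip k x ys)
  have "\<not> b x + a z \<le> 1" if "z \<in> set ys" for z
    using Skip(4) that by (auto simp: find_None_iff)
  then show ?case using Skip.IH by (auto simp: galo_find_None[OF Skip(4)])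
next
  case (Place k prev ys y)
  note st = galo_step(1-3)[OF Place(1,3), where k = k] galo_step(4,5)[OF Place(1,3)]
  let ?q = "galo a b k prev ys"
  have fit: "fits_after a b prev y" using find_Some_in_set[OF Place(3)] by simp
  let ?r = "galo a b (Suc k) (Some y) (remove1 y ys)"
  have IH1: "\<exists>v\<in>set ys. ?q v = Suc (?q u) \<and> a z \<le> a v"
    if t: "u \<in> set ys" "z \<in> set ys" "u \<noteq> y" "z \<noteq> y" "Suc (?q u) < ?q z" "b u + a z \<le> 1" for u z
  proof -
    have "u \<in> set (remove1 y ys)" "z \<in> set (remove1 y ys)" "Suc (?r u) < ?r z"
      using t st(3,4) by auto
    then obtain v where "v \<in> set (remove1 y ys)" "?r v = Suc (?r u)" "a z \<le> a v"
      using conjunct1[OF Place.IH] t(6) by blast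
    then show ?thesis using st(3,4) t(3) by (intro bexI[of _ v]) auto
  qed
  have IH2: "\<exists>v\<in>set ys. ?q v = Suc k \<and> a z \<le> a v"
    if t: "z \<in> set ys" "z \<noteq> y" "Suc k < ?q z" "b y + a z \<le> 1" for z
  proof -
    have "z \<in> set (remove1 y ys)" "Suc k < ?r z"
      using t st(3,4) by auto
    then obtain v where "v \<in> set (remove1 y ys)" "?r v = Suc k" "a z \<le> a v"
      using conjunct1[OF conjunct2[OF Place.IH]] t(4) by blast
    then show ?thesis using st(3,4) by (intro bexI[of _ v]) auto
  qed
  have IH3: "a z \<le> a u" if "u \<in> set ys" "z \<in> set ys" "u \<noteq> y" "z \<noteq> y" "?q u < ?q z" "?q u \<noteq> Suc k"
    "\<forall>x\<in>set ys. ?q u \<noteq> Suc (?q x)" for u z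
    using Place.IH that st(3-5) by auto
  have first: "a z \<le> a y" if "z \<in> set ys" "fits_after a b prev z" for z
    using find_Some_first[OF Place(3,2) that] by auto
  have "\<exists>v\<in>set ys. ?q v = Suc (?q u) \<and> a z \<le> a v"
    if "u \<in> set ys" "z \<in> set ys" "Suc (?q u) < ?q z" "b u + a z \<le> 1" for u z
    using IH1[OF that(1,2)] IH2[OF that(2)] that st(1) st(2)[of u] by (cases "u = y"; cases "z = y") auto
  moreover have "\<exists>v\<in>set ys. ?q v = k \<and> a z \<le> a v"
    if "prev = Some u" "z \<in> set ys" "k < ?q z" "b u + a z \<le> 1" for u z
    using first[OF that(2)] st(1,5) that by auto
  moreover have "a z \<le> a u"
    if "u \<in> set ys" "z \<in> set ys" "?q u < ?q z" "prev = None \<or> ?q u \<noteq> k"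
      "\<forall>x\<in>set ys. ?q u \<noteq> Suc (?q x)" for u z
  proof (cases "u = y")
    case True
    then show ?thesis using that st(1) first[of z] by auto
  next
    case False
    moreover have "?q u \<noteq> Suc k" using that(5) st(1,5) by metis
    moreover have "z \<noteq> y" using that(3) st(1) st(2)[OF that(1) False] by auto
    ultimately show ?thesis using IH3 that by blast
  qed
  ultimately show ?case by blast
qed simp

lemma feasible_if_inj_on:
  assumes "two_bar_charts S a b" "inj_on p S" "p \<in> S \<rightarrow> {1..2 * card S - 1}"
    and "\<And>x y. x \<in> S \<Longrightarrow> y \<in> S \<Longrightarrow> p y = Suc (p x) \<Longrightarrow> b x + a y \<le> 1"
  shows "feasible S a b p"
  unfolding feasible_def
proof (intro conjI ballI assms(3))
  fix k assume k: "k \<in> {1..2 * card S}"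
  have st: "starts_in S p m = {} \<or> (\<exists>x\<in>S. p x = m \<and> starts_in S p m = {x})" for m
  proof (cases "starts_in S p m = {}")
    case False
    then obtain x where "x \<in> S" "p x = m" by (auto simp: starts_in_def)
    moreover from this have "starts_in S p m = {x}"
      using assms(2) by (auto simp: starts_in_def dest: inj_onD)
    ultimately show ?thesis by blast
  qed simp
  have le: "a x \<le> 1" "b x \<le> 1" if "x \<in> S" for x
    using assms(1) that by (auto simp: two_bar_charts_def)
  from st[of k] st[of "k - 1"]
  show "(\<Sum>i\<in>starts_in S p k. a i) + (\<Sum>i\<in>starts_in S p (k - 1). b i) \<le> 1"
  proof (elim disjE bexE conjE)
    fix y x assume "y \<in> S" "p y = k" "starts_in S p k = {y}"
      "x \<in> S" "p x = k - 1" "starts_in S p (k - 1) = {x}"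
    then show ?thesis using assms(4)[of x y] k by auto
  qed (auto simp: le)
qed

lemma galo_packing_facts:
  assumes ch: "two_bar_charts S a b" and g: "galo_packing S a b p"
  shows "inj_on p S" and "p \<in> S \<rightarrow> {1..2 * card S - 1}"
    and "\<And>x y. x \<in> S \<Longrightarrow> y \<in> S \<Longrightarrow> p y = Suc (p x) \<Longrightarrow> b x + a y \<le> 1"
    and "\<And>x z. x \<in> S \<Longrightarrow> z \<in> S \<Longrightarrow> Suc (p x) < p z \<Longrightarrow> b x + a z \<le> 1 \<Longrightarrow>
      \<exists>y\<in>S. p y = Suc (p x) \<and> a z \<le> a y"
    and "\<And>y z. y \<in> S \<Longrightarrow> z \<in> S \<Longrightarrow> p y < p z \<Longrightarrow> (\<And>x. x \<in> S \<Longrightarrow> p y \<noteq> Suc (p x)) \<Longrightarrow> a z \<le> a y"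
proof -
  obtain xs where xs: "distinct xs" "set xs = S" "sorted_wrt (lex_ge a b) xs"
    and p: "\<And>i. i \<in> S \<Longrightarrow> p i = galo a b 1 None xs i"
    using g by (auto simp: galo_packing_def lex_list_def)
  have so: "sorted_wrt (\<lambda>x y. a y \<le> a x) xs"
    using xs(3) by (rule sorted_wrt_mono_rel[rotated]) (auto simp: lex_ge_def)
  have len: "length xs = card S" using distinct_card[OF xs(1)] xs(2) by simp
  let ?q = "galo a b 1 None xs"
  note r = galo_range[OF xs(1), of 1 a b None] and gr = galo_greedy[OF xs(1) so, of b 1 None]
    and f = galo_fits[OF xs(1), of a b 1 None]
  show "inj_on p S"
    using inj_on_galo[OF xs(1), of a b 1 None] p xs(2) by (simp add: inj_on_def)
  show "p \<in> S \<rightarrow> {1..2 * card S - 1}"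
    using r p xs(2) len by force
  show "b x + a y \<le> 1" if "x \<in> S" "y \<in> S" "p y = Suc (p x)" for x y
    using conjunct1[OF f] that p xs(2) by simp
  show "\<exists>y\<in>S. p y = Suc (p x) \<and> a z \<le> a y"
    if "x \<in> S" "z \<in> S" "Suc (p x) < p z" "b x + a z \<le> 1" for x z
    using conjunct1[OF gr] that p xs(2) by simp
  show "a z \<le> a y" if "y \<in> S" "z \<in> S" "p y < p z" "\<And>x. x \<in> S \<Longrightarrow> p y \<noteq> Suc (p x)" for y z
    using conjunct2[OF conjunct2[OF gr]] that p xs(2) by simp
qed

lemma galo_feasible:
  assumes "two_bar_charts S a b" "galo_packing S a b p"
  shows "feasible S a b p"
  using feasible_if_inj_on[OF assms(1)] galo_packing_facts[OF assms] by blast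

text \<open>The surplus is witnessed by two disjoint sets of charts with large second bar: the
  predecessors of the charts with small first bar, and the ends of all paths but the last. The last
  path end gives no information, as no chart remained to be refused there. This is the origin of
  \<open>Suc\<close>.\<close>

lemma galo_path_ends:
  assumes ch: "two_bar_charts S a b" and g: "galo_packing S a b p"
  obtains th where
    "card {i\<in>S. a i < th} + card (Suc ` p ` S - p ` S) \<le> Suc (card {i\<in>S. b i > 1 - th})"
proof -
  note P = galo_packing_facts[OF ch g]
  have fin: "finite S" and ne: "S \<noteq> {}" using ch by (auto simp: two_bar_charts_def)
  \<comment> \<open>The heads of the GALO paths. The last path starts at the head with the largest
    bin.\<close>
  define H where "H = {y\<in>S. \<forall>x\<in>S. p y \<noteq> Suc (p x)}"
  have head: "\<exists>h\<in>H. m < p h \<and> (\<forall>y\<in>S. m < p y \<longrightarrow> p h \<le> p y)"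
    if mS: "m \<notin> p ` S" "\<exists>y\<in>S. m < p y" for m
  proof -
    define w where "w = (LEAST k. k \<in> p ` S \<and> m < k)"
    obtain y0 where "y0 \<in> S" "m < p y0" using mS(2) by blast
    then have w: "w \<in> p ` S" "m < w"
      unfolding w_def using LeastI[of "\<lambda>k. k \<in> p ` S \<and> m < k" "p y0"] by auto
    have least: "w \<le> k" if "k \<in> p ` S" "m < k" for k
      unfolding w_def using that by (intro Least_le) simp
    obtain h where h: "h \<in> S" "w = p h" using w(1) by auto
    have "p h \<noteq> Suc (p x)" if "x \<in> S" for x
    proof
      assume "p h = Suc (p x)"
      moreover have "p x \<noteq> m" using mS(1) that by auto
      ultimately have "m < p x" "p x < w" using w(2) h by auto
      then show False using least[of "p x"] that by auto
    qed
    then show ?thesis using h w(2) least by (intro bexI[of _ h]) (auto simp: H_def)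
  qed
  have "0 \<notin> p ` S" "\<exists>y\<in>S. 0 < p y" using P(2) ne by (fastforce simp: Pi_iff)+
  from head[OF this] have "H \<noteq> {}" by blast
  moreover have "finite H" using fin by (simp add: H_def)
  ultimately have "Max (p ` H) \<in> p ` H" by simp
  then obtain h where h: "h \<in> H" "Max (p ` H) = p h" by auto
  have hmax: "p y \<le> p h" if "y \<in> H" for y
    using that \<open>finite H\<close> h(2) by (metis Max_ge finite_imageI imageI)
  have hS: "h \<in> S" using h by (simp add: H_def)
  define Z where "Z = {z\<in>S. p h \<le> p z}"
  have "finite (a ` Z)" "a ` Z \<noteq> {}" using fin hS by (auto simp: Z_def)
  then have "Min (a ` Z) \<in> a ` Z" by (rule Min_in)
  then obtain z where z: "z \<in> Z" "Min (a ` Z) = a z" by auto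
  have zmin: "a z \<le> a y" if "y \<in> S" "p h \<le> p y" for y
    using that \<open>finite (a ` Z)\<close> z(2) by (metis (mono_tags, lifting) Min_le Z_def imageI mem_Collect_eq)
  have zS: "z \<in> S" "p h \<le> p z" using z(1) by (auto simp: Z_def)
  \<comment> \<open>The chart \<open>z\<close> is available until the last path is started, and it is refused at the end of
    every other path and whenever a chart with a smaller first bar is chosen.\<close>
  define J where "J = {i\<in>S. a i < a z}"
  define I where "I = {i\<in>S. b i > 1 - a z}"
  define Q where "Q = {i\<in>S. Suc (p i) \<in> p ` J}"
  define E where "E = {i\<in>S. Suc (p i) \<notin> p ` S}"
  have "Max (p ` S) \<in> p ` S" using fin ne by simp
  then obtain l where l: "l \<in> S" "Max (p ` S) = p l" by auto
  have lmax: "p y \<le> p l" if "y \<in> S" for y using that fin l(2) by (metis Max_ge finite_imageI imageI)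
  \<comment> \<open>If \<open>i\<close> left room for \<open>z\<close>, the next bin would hold a
    chart with first bar at least \<open>a z\<close>. It holds only \<open>j\<close>, and
    \<open>a j < a z\<close>.\<close>
  have QI: "Q \<subseteq> I"
  proof
    fix i assume "i \<in> Q"
    then obtain j where i: "i \<in> S" and j: "j \<in> S" "a j < a z" "p j = Suc (p i)"
      by (auto simp: Q_def J_def)
    have "p j < p h" using zmin[OF j(1)] j(2) by force
    then have "Suc (p i) < p z" using j(3) zS(2) by simp
    have "\<not> b i + a z \<le> 1"
    proof
      assume "b i + a z \<le> 1"
      then obtain y where "y \<in> S" "p y = Suc (p i)" "a z \<le> a y"
        using P(4)[OF i zS(1) \<open>Suc (p i) < p z\<close>] by blast
      then have "y = j" using P(1) j by (metis inj_onD)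
      then show False using j(2) \<open>a z \<le> a y\<close> by simp
    qed
    then show "i \<in> I" using i by (simp add: I_def)
  qed
  \<comment> \<open>After the end \<open>i\<close> of an earlier path a bin stays empty while
    \<open>z\<close> is still in the list, so \<open>z\<close> did not fit.\<close>
  have EI: "E - {l} \<subseteq> I"
  proof
    fix i assume "i \<in> E - {l}"
    then have i: "i \<in> S" "Suc (p i) \<notin> p ` S" "i \<noteq> l" by (auto simp: E_def)
    have "p i \<noteq> p l" using P(1) i(1,3) l(1) by (auto dest: inj_onD)
    moreover have "p l \<noteq> Suc (p i)" using i(2) l(1) by (metis imageI)
    ultimately have "Suc (p i) < p l" using lmax[OF i(1)] by simp
    then obtain y where "y \<in> H" "Suc (p i) < p y"
      using head[OF i(2)] l(1) by blast
    then have lt: "Suc (p i) < p z" using hmax[of y] zS(2) by simp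
    have "\<not> b i + a z \<le> 1"
      using P(4)[OF i(1) zS(1) lt] i(2) by (metis imageI)
    then show "i \<in> I" using i by (simp add: I_def)
  qed
  \<comment> \<open>A chart with first bar below \<open>a z\<close> lies before the last path. It
    cannot be a path head, because a head is chosen when \<open>z\<close> fits as well, so it has a
    predecessor.\<close>
  have "Suc ` p ` Q = p ` J"
  proof
    show "p ` J \<subseteq> Suc ` p ` Q"
    proof
      fix k assume "k \<in> p ` J"
      then obtain j where j: "k = p j" "j \<in> S" "a j < a z" by (auto simp: J_def)
      have "p j < p h" using zmin[OF j(2)] j(3) by force
      then have "p j < p z" using zS(2) by simp
      then obtain i where "i \<in> S" "p j = Suc (p i)"
        using P(5)[OF j(2) zS(1)] j(3) by force
      then show "k \<in> Suc ` p ` Q" using \<open>k \<in> p ` J\<close> j(1) by (auto simp: Q_def)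
    qed
  qed (auto simp: Q_def)
  then have "card (p ` J) = card (Suc ` p ` Q)" by simp
  moreover have "card (p ` J) = card J"
    using P(1) by (intro card_image) (auto simp: J_def inj_on_def)
  moreover have "card (Suc ` p ` Q) = card Q"
    using P(1) by (subst card_image, simp, intro card_image) (auto simp: Q_def inj_on_def)
  ultimately have JQ: "card J = card Q" by simp
  have "Suc ` p ` S - p ` S = Suc ` p ` E" by (auto simp: E_def)
  moreover have "card (Suc ` p ` E) = card E"
    using P(1) by (subst card_image, simp, intro card_image) (auto simp: E_def inj_on_def)
  ultimately have CE: "card (Suc ` p ` S - p ` S) = card E" by simp
  have fins: "finite E" "finite Q" "finite I" using fin by (auto simp: E_def Q_def I_def)
  have "Q \<inter> (E - {l}) = {}" by (auto simp: Q_def E_def J_def)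
  then have "card Q + card (E - {l}) = card (Q \<union> (E - {l}))"
    using fins by (simp add: card_Un_disjoint)
  also have "\<dots> \<le> card I" using QI EI fins by (intro card_mono) auto
  finally have "card Q + card (E - {l}) \<le> card I" .
  moreover have "card E \<le> Suc (card (E - {l}))"
    using card_Suc_Diff1[of E l] fins by (cases "l \<in> E") simp_all
  ultimately show ?thesis
    using that[of "a z"] JQ CE by (simp add: J_def I_def)
qed

lemma packing_length_cong:
  assumes "\<And>i. i \<in> S \<Longrightarrow> p i = q i"
  shows "packing_length S p = packing_length S q"
  unfolding packing_length_def using assms by (intro arg_cong[where f = card]) auto

lemma feasible_cong:
  assumes "\<And>i. i \<in> S \<Longrightarrow> p i = q i"
  shows "feasible S a b p = feasible S a b q"
proof -
  have "starts_in S p = starts_in S q" using assms by (auto simp: starts_in_def fun_eq_iff)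
  moreover have "p \<in> S \<rightarrow> A \<longleftrightarrow> q \<in> S \<rightarrow> A" for A using assms by (auto simp: Pi_iff)
  ultimately show ?thesis by (simp add: feasible_def)
qed

lemma app_guarantee:
  assumes ch: "two_bar_charts S a b" and big: "\<forall>i\<in>S. big a b i"
    and run: "app_run S a b pg M pm pa"
  shows "feasible S a b pa" and "real (packing_length S pa) \<le> 4/3 * real (OPT S a b) + 2/3"
proof -
  have fin: "finite S" using ch by (simp add: two_bar_charts_def)
  from run have g: "galo_packing S a b pg" and mm: "maximum_matching (chart_edges S a b) M"
    and mp: "matching_packing S a b M pm"
    and out: "(\<forall>i\<in>S. pa i = pg i) \<and> packing_length S pg \<le> packing_length S pm \<or>
      (\<forall>i\<in>S. pa i = pm i) \<and> packing_length S pm \<le> packing_length S pg"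
    by (auto simp: app_run_def)
  have fg: "feasible S a b pg" by (rule galo_feasible[OF ch g])
  have fm: "feasible S a b pm" using mp by (simp add: matching_packing_def)
  show fa: "feasible S a b pa"
    using out fg fm feasible_cong[of S pa pg] feasible_cong[of S pa pm] by blast
  have len: "packing_length S pa \<le> packing_length S pg" "packing_length S pa \<le> packing_length S pm"
    using out packing_length_cong[of S pa pg] packing_length_cong[of S pa pm] by auto
  obtain p where p: "feasible S a b p" "packing_length S p = OPT S a b"
    using OPT_attained[OF fg] .
  let ?r = "card (Suc ` p ` S - p ` S)" and ?c = "card (Suc ` pg ` S - pg ` S)"
  have Lp: "OPT S a b = card (p ` S) + ?r"
    using packing_length_run_ends[OF fin, of p] p by (simp add: feasible_def)
  have nL: "card S \<le> OPT S a b" using card_le_packing_length[OF ch big p(1)] p(2) by simp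
  have t: "card S \<le> card (p ` S) + card M"
    by (rule card_le_starts_plus_matching[OF ch big p(1) mm])
  have Lm: "packing_length S pm + 2 * card M \<le> 2 * card S"
    using matching_packing_length[OF fin mp] mm by (simp add: maximum_matching_def)
  have Lg: "packing_length S pg = card S + ?c"
    using packing_length_run_ends[OF fin, of pg] galo_packing_facts(1,2)[OF ch g]
    by (simp add: card_image)
  obtain th where "card {i\<in>S. a i < th} + ?c \<le> Suc (card {i\<in>S. b i > 1 - th})"
    using galo_path_ends[OF ch g] .
  then have "?c \<le> Suc ?r" using run_ends_lower_bound[OF ch big p(1), of th] by simp
  \<comment> \<open>With \<open>s\<close> start bins and \<open>r\<close> runs in \<open>p\<close>,
    the matching packing has length at most \<open>2 s\<close> and GALO at most
    \<open>s + 2 r + 1\<close>. Weights one and two give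
    \<open>2 s + 2 (s + 2 r + 1) = 4 (s + r) + 2\<close>.\<close>
  then have "3 * packing_length S pa \<le> 4 * OPT S a b + 2"
    using Lp nL t Lm Lg len by linarith
  then show "real (packing_length S pa) \<le> 4/3 * real (OPT S a b) + 2/3" by linarith
qed

section \<open>A tight instance\<close>

text \<open>Equality in the guarantee requires \<open>n = s + r\<close> and
  \<open>2 s = s + 2 r + 1\<close>. The smallest solution \<open>r = 1\<close>, \<open>s = 3\<close>
  asks for four charts, optimum 4 and output length 6. Chart 1 is the trap: GALO takes it right
  after chart 0, and its second bar 9/10 lets no other chart follow. An optimal packing puts it
  last.\<close>

definition tight_a :: "nat \<Rightarrow> real" where
  "tight_a i = (if i = 0 then 3/5 else if i = 1 then 2/5 else if i = 2 then 3/10 else 1/5)"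

definition tight_b :: "nat \<Rightarrow> real" where
  "tight_b i = (if i = 0 then 1/5 else if i = 1 then 9/10 else 3/5)"

lemma tight_galo:
  "galo tight_a tight_b 1 None [0, 1, 2, 3] = (\<lambda>_. 0)(3 := 5, 2 := 4, 1 := 2, 0 := 1)"
  by (simp add: tight_a_def tight_b_def eval_nat_numeral)

lemma lessThan_4: "{..<4::nat} = {0, 1, 2, 3}"
  by auto

lemma atLeastAtMost_1_8: "{1..8::nat} = {1, 2, 3, 4, 5, 6, 7, 8}"
  by auto

lemma tight_feasible:
  assumes "\<forall>i<4. 1 \<le> p i \<and> p i \<le> 7"
    "\<forall>k\<in>{1, 2, 3, 4, 5, 6, 7, 8::nat}. (\<Sum>i\<in>{0, 1, 2, 3}. if p i = k then tight_a i else 0) +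
      (\<Sum>i\<in>{0, 1, 2, 3}. if p i = k - 1 then tight_b i else 0) \<le> 1"
  shows "feasible {..<4} tight_a tight_b p"
proof -
  have filt: "(\<Sum>i\<in>starts_in {..<4} p k. f i) = (\<Sum>i\<in>{0, 1, 2, 3}. if p i = k then f i else 0)"
    for f :: "nat \<Rightarrow> real" and k
    unfolding starts_in_def lessThan_4 by (rule sum.inter_filter) simp
  show ?thesis
    unfolding feasible_def filt
  proof (intro conjI ballI)
    show "p \<in> {..<4} \<rightarrow> {1..2 * card {..<4::nat} - 1}" using assms(1) by auto
  next
    fix k assume "k \<in> {1..2 * card {..<4::nat}}"
    then have "k \<in> {1..8}" by simp
    with assms(2) show "(\<Sum>i\<in>{0, 1, 2, 3}. if p i = k then tight_a i else 0) +
      (\<Sum>i\<in>{0, 1, 2, 3}. if p i = k - 1 then tight_b i else 0) \<le> 1"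
      unfolding atLeastAtMost_1_8 by blast
  qed
qed

lemma tight_charts: "two_bar_charts {..<4} tight_a tight_b"
  by (auto simp: two_bar_charts_def tight_a_def tight_b_def lessThan_4)

lemma tight_big: "\<forall>i\<in>{..<4}. big tight_a tight_b i"
  by (auto simp: big_def tight_a_def tight_b_def)

lemma tight_OPT: "OPT {..<4} tight_a tight_b = 4"
proof (rule antisym)
  \<comment> \<open>Charts 0 and 2 share bin 1, followed by 3 and then 1. Bins 2 and 3 are filled
    exactly: \<open>1/5 + 3/5 + 1/5\<close> and \<open>3/5 + 2/5\<close>.\<close>
  let ?p = "(\<lambda>_. 1)(1 := 3, 3 := 2) :: nat \<Rightarrow> nat"
  have fe: "feasible {..<4} tight_a tight_b ?p"
    by (rule tight_feasible) (simp_all add: tight_a_def tight_b_def)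
  have "?p ` {..<4} \<union> Suc ` ?p ` {..<4} = {1, 2, 3, 4}"
    unfolding lessThan_4 by auto
  then have "packing_length {..<4} ?p = 4"
    using fe by (subst packing_length_image) (auto simp: feasible_def)
  then show "OPT {..<4} tight_a tight_b \<le> 4" using OPT_le_packing_length[OF fe] by simp
  obtain q where "feasible {..<4} tight_a tight_b q"
    "packing_length {..<4} q = OPT {..<4} tight_a tight_b" using OPT_attained[OF fe] .
  then show "4 \<le> OPT {..<4} tight_a tight_b"
    using card_le_packing_length[OF tight_charts tight_big] by fastforce
qed

text \<open>Only chart 0 has a second bar of at most 1/2, so all edges meet in chart 0.\<close>

lemma tight_maximum_matching: "maximum_matching (chart_edges {..<4} tight_a tight_b) {{0, 2}}"
  unfolding maximum_matching_def
proof (intro conjI allI impI)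
  have "{0, 2} \<in> chart_edges {..<4} tight_a tight_b"
    unfolding chart_edges_def by (rule CollectI, rule exI[of _ 0], rule exI[of _ 2])
      (simp add: tight_a_def tight_b_def)
  then show "matching (chart_edges {..<4} tight_a tight_b) {{0, 2}}"
    by (simp add: matching_def)
next
  fix M assume M: "matching (chart_edges {..<4} tight_a tight_b) M"
  have "0 \<in> e" if "e \<in> M" for e
  proof -
    have "e \<in> chart_edges {..<4} tight_a tight_b" using M that by (auto simp: matching_def)
    then show ?thesis
      by (auto simp: chart_edges_def tight_a_def tight_b_def split: if_splits)
  qed
  then have "e = f" if "e \<in> M" "f \<in> M" for e f
    using that M unfolding matching_def pairwise_def disjnt_iff by blast
  then have "card M \<le> Suc 0"
    by (cases "finite M") (simp_all add: card_le_Suc0_iff_eq)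
  then show "card M \<le> card {{0, 2 :: nat}}" by simp
qed

lemma app_guarantee_tight:
  "\<exists>(S :: nat set) a b pg M pm pa.
     two_bar_charts S a b \<and> (\<forall>i\<in>S. big a b i) \<and> app_run S a b pg M pm pa \<and>
     real (packing_length S pa) = 4/3 * real (OPT S a b) + 2/3"
proof -
  let ?pg = "(\<lambda>_. 0)(3 := 5, 2 := 4, 1 := 2, 0 := 1) :: nat \<Rightarrow> nat"
  let ?pm = "(\<lambda>_. 1)(1 := 5, 3 := 3) :: nat \<Rightarrow> nat"
  have "lex_list {..<4} tight_a tight_b [0, 1, 2, 3]"
    by (auto simp: lex_list_def lex_ge_def tight_a_def tight_b_def)
  then have g: "galo_packing {..<4} tight_a tight_b ?pg"
    unfolding galo_packing_def using tight_galo by metis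
  have "feasible {..<4} tight_a tight_b ?pm"
    by (rule tight_feasible) (simp_all add: tight_a_def tight_b_def)
  then have m: "matching_packing {..<4} tight_a tight_b {{0, 2}} ?pm"
    by (auto simp: matching_packing_def doubleton_eq_iff)
  have "?pg ` {..<4} \<union> Suc ` ?pg ` {..<4} = {1, 2, 3, 4, 5, 6}"
    "?pm ` {..<4} \<union> Suc ` ?pm ` {..<4} = {1, 2, 3, 4, 5, 6}"
    unfolding lessThan_4 by auto
  then have len: "packing_length {..<4} ?pg = 6" "packing_length {..<4} ?pm = 6"
    by (subst packing_length_image; force)+
  have "app_run {..<4} tight_a tight_b ?pg {{0, 2}} ?pm ?pg"
    unfolding app_run_def using g m len tight_maximum_matching by simp
  moreover have "real (packing_length {..<4} ?pg) = 4/3 * real (OPT {..<4} tight_a tight_b) + 2/3"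
    unfolding len tight_OPT by simp
  ultimately show ?thesis using tight_charts tight_big by blast
qed

section \<open>Cost-bounded execution of programs\<close>

text \<open>Total correctness with a cost bound. Since execution is deterministic, asking for one
  execution is the same as speaking of the only one.\<close>

definition runs :: "com \<Rightarrow> store \<Rightarrow> nat \<Rightarrow> (store \<Rightarrow> bool) \<Rightarrow> bool" where
  "runs c s B Q \<longleftrightarrow> (\<exists>t s'. exec c s t s' \<and> t \<le> B \<and> Q s')"

lemma runs_conseq:
  "runs c s B Q \<Longrightarrow> B \<le> B' \<Longrightarrow> (\<And>s'. Q s' \<Longrightarrow> Q' s') \<Longrightarrow> runs c s B' Q'"
  unfolding runs_def by (meson le_trans)

lemma runs_Skip: "Q s \<Longrightarrow> 1 \<le> B \<Longrightarrow> runs Skip s B Q"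
  unfolding runs_def using exec.Skip by blast

lemma runs_NAssign:
  "Q (nwrite x (nval e s) (nval f s) s) \<Longrightarrow> ncost e + ncost f + 1 \<le> B \<Longrightarrow>
   runs (NAssign x e f) s B Q"
  unfolding runs_def using exec.NAssign by blast

lemma runs_RAssign:
  "Q (rwrite x (nval e s) (rval f s) s) \<Longrightarrow> ncost e + rcost f + 1 \<le> B \<Longrightarrow>
   runs (RAssign x e f) s B Q"
  unfolding runs_def using exec.RAssign by blast

lemma runs_Seq:
  "runs c s B (\<lambda>s'. runs d s' B' Q) \<Longrightarrow> runs (Seq c d) s (B + B') Q"
  unfolding runs_def by (meson exec.Seq add_mono)

lemma runs_Branch:
  assumes "bval g s \<Longrightarrow> runs c s B Q" "\<not> bval g s \<Longrightarrow> runs d s B Q"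
  shows "runs (Branch g c d) s (bcost g + 1 + B) Q"
proof (cases "bval g s")
  case True
  then obtain t s' where "exec c s t s'" "t \<le> B" "Q s'" using assms(1) by (auto simp: runs_def)
  then show ?thesis
    unfolding runs_def using exec.BranchTrue[OF True] by (meson add_left_mono)
next
  case False
  then obtain t s' where "exec d s t s'" "t \<le> B" "Q s'" using assms(2) by (auto simp: runs_def)
  then show ?thesis
    unfolding runs_def using exec.BranchFalse[OF False] by (meson add_left_mono)
qed

primrec nmods :: "com \<Rightarrow> vname set" where
  "nmods Skip = {}"
| "nmods (NAssign x e f) = {x}"
| "nmods (RAssign x e f) = {}"
| "nmods (Seq c d) = nmods c \<union> nmods d"
| "nmods (Branch g c d) = nmods c \<union> nmods d"
| "nmods (While g c) = nmods c"

primrec rmods :: "com \<Rightarrow> vname set" where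
  "rmods Skip = {}"
| "rmods (NAssign x e f) = {}"
| "rmods (RAssign x e f) = {x}"
| "rmods (Seq c d) = rmods c \<union> rmods d"
| "rmods (Branch g c d) = rmods c \<union> rmods d"
| "rmods (While g c) = rmods c"

lemma nmem_nwrite [simp]:
  "nmem (nwrite x k v s) y = (if y = x then (nmem s x)(k := v) else nmem s y)"
  by (simp add: nwrite_def)

lemma rmem_nwrite [simp]: "rmem (nwrite x k v s) = rmem s"
  by (simp add: nwrite_def)

lemma rmem_rwrite [simp]:
  "rmem (rwrite x k v s) y = (if y = x then (rmem s x)(k := v) else rmem s y)"
  by (simp add: rwrite_def)

lemma nmem_rwrite [simp]: "nmem (rwrite x k v s) = nmem s"
  by (simp add: rwrite_def)

lemma exec_frame:
  "exec c s t s' \<Longrightarrow> (\<forall>x. x \<notin> nmods c \<longrightarrow> nmem s' x = nmem s x) \<and>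
     (\<forall>x. x \<notin> rmods c \<longrightarrow> rmem s' x = rmem s x)"
  by (induction rule: exec.induct) auto

definition same_off :: "com \<Rightarrow> store \<Rightarrow> store \<Rightarrow> bool" where
  "same_off c s s' \<longleftrightarrow> (\<forall>x. x \<notin> nmods c \<longrightarrow> nmem s' x = nmem s x) \<and>
     (\<forall>x. x \<notin> rmods c \<longrightarrow> rmem s' x = rmem s x)"

text \<open>With this rule the specification of a phase need only mention its own result. The arrays
  of the other phases are preserved for syntactic reasons.\<close>

lemma runs_frame: "runs c s B Q \<Longrightarrow> runs c s B (\<lambda>s'. Q s' \<and> same_off c s s')"
  unfolding runs_def same_off_def using exec_frame by blast

definition For :: "vname \<Rightarrow> nexp \<Rightarrow> com \<Rightarrow> com" where
  "For i e c = Seq (NAssign i (NConst 0) (NConst 0))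
     (While (NLe (NPlus (NRead i (NConst 0)) (NConst 1)) e)
       (Seq c (NAssign i (NConst 0) (NPlus (NRead i (NConst 0)) (NConst 1)))))"

text \<open>The invariant is asked for after the counter has been increased. A round costs
  \<open>ncost e + 6\<close> for the test and 6 for the increment besides the body. The final test
  and the initial assignment make up \<open>ncost e + 9\<close>.\<close>

lemma runs_For:
  assumes i: "i \<notin> nmods c"
    and N: "\<And>k s. Inv k s \<Longrightarrow> nval e s = N"
    and step: "\<And>k s. k < N \<Longrightarrow> nmem s i 0 = k \<Longrightarrow> Inv k s \<Longrightarrow>
      runs c s B (\<lambda>s'. Inv (Suc k) (nwrite i 0 (Suc k) s'))"
    and init: "Inv 0 (nwrite i 0 0 s)"
  shows "runs (For i e c) s (N * (B + ncost e + 12) + ncost e + 9) (Inv N)"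
proof -
  let ?g = "NLe (NPlus (NRead i (NConst 0)) (NConst 1)) e"
  let ?body = "Seq c (NAssign i (NConst 0) (NPlus (NRead i (NConst 0)) (NConst 1)))"
  have W: "runs (While ?g ?body) s ((N - k) * (B + ncost e + 12) + ncost e + 6) (Inv N)"
    if "k \<le> N" "nmem s i 0 = k" "Inv k s" for k s
    using that
  proof (induction "N - k" arbitrary: k s)
    case 0
    then have "k = N" by simp
    then have "exec (While ?g ?body) s (bcost ?g + 1) s"
      using 0 N[of k s] by (intro exec.WhileFalse) simp
    then show ?case
      using 0 \<open>k = N\<close> unfolding runs_def by (intro exI conjI) (assumption, simp_all)
  next
    case (Suc d)
    then have k: "k < N" by simp
    have g: "bval ?g s" using k Suc.prems N[of k s] by simp
    obtain t s' where s': "exec c s t s'" "t \<le> B" "Inv (Suc k) (nwrite i 0 (Suc k) s')"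
      using step[OF k Suc.prems(2,3)] by (auto simp: runs_def)
    have "nmem s' i 0 = k" using exec_frame[OF s'(1)] i Suc.prems(2) by simp
    then have "exec ?body s (t + 6) (nwrite i 0 (Suc k) s')"
      using exec.Seq[OF s'(1) exec.NAssign[of i "NConst 0" "NPlus (NRead i (NConst 0)) (NConst 1)"]]
      by (simp add: eval_nat_numeral)
    moreover have "runs (While ?g ?body) (nwrite i 0 (Suc k) s')
        ((N - Suc k) * (B + ncost e + 12) + ncost e + 6) (Inv N)"
      using Suc.hyps(2) k s'(3) by (intro Suc.hyps(1)) auto
    then obtain t' s'' where s'': "exec (While ?g ?body) (nwrite i 0 (Suc k) s') t' s''"
      "t' \<le> (N - Suc k) * (B + ncost e + 12) + ncost e + 6" "Inv N s''"
      by (auto simp: runs_def)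
    ultimately have "exec (While ?g ?body) s (bcost ?g + 1 + (t + 6) + t') s''"
      using exec.WhileTrue[OF g] by blast
    moreover have "(N - k) * (B + ncost e + 12) = (N - Suc k) * (B + ncost e + 12) + (B + ncost e + 12)"
      unfolding Suc_diff_Suc[OF k, symmetric] by simp
    then have "bcost ?g + 1 + (t + 6) + t' \<le> (N - k) * (B + ncost e + 12) + ncost e + 6"
      using s''(2) s'(2) by simp
    ultimately show ?case using s''(3) unfolding runs_def by blast
  qed
  have "runs (For i e c) s (3 + ((N - 0) * (B + ncost e + 12) + ncost e + 6)) (Inv N)"
    unfolding For_def by (rule runs_Seq, rule runs_NAssign, rule W) (use init in auto)
  then show ?thesis by (rule runs_conseq) auto
qed

lemma mods_For [simp]: "nmods (For i e c) = insert i (nmods c)" "rmods (For i e c) = rmods c"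
  by (auto simp: For_def)

abbreviation V :: "vname \<Rightarrow> nexp" where "V x \<equiv> NRead x (NConst 0)"
abbreviation Vpred :: "vname \<Rightarrow> nexp" where "Vpred x \<equiv> NMinus (V x) (NConst 1)"

text \<open>\<open>Scan g x y\<close> stores in \<open>q\<close> the successor of the first \<open>i\<close> with property \<open>g\<close> for which
  \<open>(x i, y i)\<close> is lexicographically maximal, and \<open>0\<close> if there is no such \<open>i\<close>.\<close>

definition Scan :: "bexp \<Rightarrow> vname \<Rightarrow> vname \<Rightarrow> com" where
  "Scan g x y = Seq (NAssign ''q'' (NConst 0) (NConst 0))
     (For ''i'' (V ''n'')
       (Branch (BAnd g (BNot (BAnd (NLe (NConst 1) (V ''q''))
            (BAnd (RLe (RRead x (V ''i'')) (RRead x (Vpred ''q'')))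
              (BNot (BAnd (RLe (RRead x (Vpred ''q'')) (RRead x (V ''i'')))
                 (BNot (RLe (RRead y (V ''i'')) (RRead y (Vpred ''q''))))))))))
         (NAssign ''q'' (NConst 0) (NPlus (V ''i'') (NConst 1)))
         Skip))"

definition best :: "nat \<Rightarrow> (nat \<Rightarrow> bool) \<Rightarrow> (nat \<Rightarrow> real) \<Rightarrow> (nat \<Rightarrow> real) \<Rightarrow> nat \<Rightarrow> bool" where
  "best n G x y q \<longleftrightarrow>
     (case q of 0 \<Rightarrow> \<forall>i<n. \<not> G i
      | Suc m \<Rightarrow> m < n \<and> G m \<and> (\<forall>i<n. G i \<longrightarrow> lex_ge x y m i \<and> (lex_ge x y i m \<longrightarrow> m \<le> i)))"

lemma lex_ge_total: "lex_ge a b i j \<or> lex_ge a b j i"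
  by (auto simp: lex_ge_def)

lemma lex_ge_trans: "lex_ge a b i j \<Longrightarrow> lex_ge a b j k \<Longrightarrow> lex_ge a b i k"
  by (auto simp: lex_ge_def)

lemma lex_ge_refl: "lex_ge a b i i"
  by (auto simp: lex_ge_def)

lemma best_simps [simp]:
  "best n G x y 0 \<longleftrightarrow> (\<forall>i<n. \<not> G i)"
  "best n G x y (Suc m) \<longleftrightarrow>
     m < n \<and> G m \<and> (\<forall>i<n. G i \<longrightarrow> lex_ge x y m i \<and> (lex_ge x y i m \<longrightarrow> m \<le> i))"
  by (simp_all add: best_def)

text \<open>The incumbent gives way only to a strictly better candidate, so among equals the least
  index survives.\<close>

lemma best_Suc:
  assumes "best k G x y q"
  shows "best (Suc k) G x y (if G k \<and> \<not> (1 \<le> q \<and> lex_ge x y (q - 1) k) then Suc k else q)"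
proof (cases q)
  case 0
  then show ?thesis using assms by (cases "G k") (simp_all add: less_Suc_eq lex_ge_refl)
next
  case (Suc m)
  with assms have m: "m < k" "G m" "\<And>i. i < k \<Longrightarrow> G i \<Longrightarrow> lex_ge x y m i"
    "\<And>i. i < k \<Longrightarrow> G i \<Longrightarrow> lex_ge x y i m \<Longrightarrow> m \<le> i" by auto
  show ?thesis
  proof (cases "G k \<and> \<not> lex_ge x y m k")
    case True
    then have km: "lex_ge x y k m" using lex_ge_total[of x y k m] by blast
    have "lex_ge x y k i \<and> (lex_ge x y i k \<longrightarrow> k \<le> i)" if "i < Suc k" "G i" for i
    proof (cases "i = k")
      case False
      then have "lex_ge x y m i" using m(3) that by simp
      then show ?thesis using lex_ge_trans[OF km] lex_ge_trans[of x y m i k] True by blast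
    qed (simp add: lex_ge_refl)
    then show ?thesis using Suc True by simp
  next
    case False
    then have "G k \<Longrightarrow> lex_ge x y m k" by blast
    then have "lex_ge x y m i \<and> (lex_ge x y i m \<longrightarrow> m \<le> i)" if "i < Suc k" "G i" for i
      using m that by (cases "i = k") auto
    moreover have "(if G k \<and> \<not> (1 \<le> q \<and> lex_ge x y (q - 1) k) then Suc k else q) = Suc m"
      using Suc False by auto
    ultimately show ?thesis using m(1,2) by simp
  qed
qed

definition scan_cost :: "bexp \<Rightarrow> nat \<Rightarrow> nat" where
  "scan_cost g n = n * (bcost g + 60) + 20"

text \<open>The guard may consult the current index and whatever the scan leaves unchanged. Its
  meaning \<open>G\<close> is then the same in all rounds.\<close>

lemma runs_Scan:
  assumes g: "\<And>s'. (\<forall>v. v \<notin> {''q'', ''i''} \<longrightarrow> nmem s' v = nmem s v) \<Longrightarrow> rmem s' = rmem s \<Longrightarrow>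
      bval g s' \<longleftrightarrow> G (nmem s' ''i'' 0)"
    and n: "nmem s ''n'' 0 = n"
  shows "runs (Scan g x y) s (scan_cost g n) (\<lambda>s'. best n G (rmem s x) (rmem s y) (nmem s' ''q'' 0) \<and>
    (\<forall>v. v \<notin> {''q'', ''i''} \<longrightarrow> nmem s' v = nmem s v) \<and> rmem s' = rmem s)"
proof -
  let ?Inv = "\<lambda>k s'. best k G (rmem s x) (rmem s y) (nmem s' ''q'' 0) \<and>
    (\<forall>v. v \<notin> {''q'', ''i''} \<longrightarrow> nmem s' v = nmem s v) \<and> rmem s' = rmem s"
  have "runs (Scan g x y) s (3 + (n * ((bcost g + 38 + 1 + 6) + ncost (V ''n'') + 12) + ncost (V ''n'') + 9)) (?Inv n)"
    unfolding Scan_def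
  proof (rule runs_Seq, rule runs_NAssign, rule runs_For[where N = n])
    fix k and s' :: store
    assume k: "k < n" "nmem s' ''i'' 0 = k" and I: "?Inv k s'"
    let ?g = "BAnd g (BNot (BAnd (NLe (NConst 1) (V ''q''))
            (BAnd (RLe (RRead x (V ''i'')) (RRead x (Vpred ''q'')))
              (BNot (BAnd (RLe (RRead x (Vpred ''q'')) (RRead x (V ''i'')))
                 (BNot (RLe (RRead y (V ''i'')) (RRead y (Vpred ''q'')))))))))"
    let ?q = "nmem s' ''q'' 0"
    have I2: "\<forall>v. v \<notin> {''q'', ''i''} \<longrightarrow> nmem s' v = nmem s v" and I3: "rmem s' = rmem s"
      and I1: "best k G (rmem s x) (rmem s y) ?q"
      using I by blast+
    have "bval g s' \<longleftrightarrow> G k" using g[OF I2 I3] unfolding k(2) .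
    then have bv: "bval ?g s' \<longleftrightarrow> G k \<and> \<not> (1 \<le> ?q \<and> lex_ge (rmem s x) (rmem s y) (?q - 1) k)"
      unfolding lex_ge_def by (auto simp: k(2) I3)
    have q: "best (Suc k) G (rmem s x) (rmem s y) (if bval ?g s' then Suc k else ?q)"
      unfolding bv by (rule best_Suc[OF I1])
    show "runs (Branch ?g (NAssign ''q'' (NConst 0) (NPlus (V ''i'') (NConst 1))) Skip) s'
       (bcost g + 38 + 1 + 6) (\<lambda>s'. ?Inv (Suc k) (nwrite ''i'' 0 (Suc k) s'))"
    proof (rule runs_conseq, rule runs_Branch[where B = 6])
      assume b: "bval ?g s'"
      show "runs (NAssign ''q'' (NConst 0) (NPlus (V ''i'') (NConst 1))) s' 6
        (\<lambda>s'. ?Inv (Suc k) (nwrite ''i'' 0 (Suc k) s'))"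
        using q[unfolded if_P[OF b]] I2 I3 k(2) by (intro runs_NAssign) simp_all
    next
      assume b: "\<not> bval ?g s'"
      show "runs Skip s' 6 (\<lambda>s'. ?Inv (Suc k) (nwrite ''i'' 0 (Suc k) s'))"
        using q[unfolded if_not_P[OF b]] I2 I3 k(2) by (intro runs_Skip) simp_all
    qed simp_all
  qed (use n in \<open>auto simp: best_def\<close>)
  then show ?thesis by (rule runs_conseq) (auto simp: scan_cost_def algebra_simps)
qed

section \<open>Greedy choices\<close>

lemma ex_sorted_wrt:
  assumes "finite S" and total: "\<And>x y. R x y \<or> R y x"
    and trans: "\<And>x y z. R x y \<Longrightarrow> R y z \<Longrightarrow> R x z"
  shows "\<exists>xs. distinct xs \<and> set xs = S \<and> sorted_wrt R xs"
  using assms(1)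
proof induction
  case (insert x F)
  then obtain xs where xs: "distinct xs" "set xs = F" "sorted_wrt R xs" by auto
  let ?ys = "filter (\<lambda>y. R y x) xs @ x # filter (\<lambda>y. \<not> R y x) xs"
  have after: "R x y" if "\<not> R y x" for y using total[of x y] that by blast
  have "R u v" if "R u x" "\<not> R v x" for u v using trans[OF that(1) after[OF that(2)]] .
  with after have "sorted_wrt R ?ys"
    unfolding sorted_wrt_append sorted_wrt.simps
    by (intro conjI ballI sorted_wrt_filter[OF xs(3)]; unfold set_filter list.set) blast+
  moreover have "distinct ?ys" "set ?ys = insert x F" using xs insert.hyps by auto
  ultimately show ?case by blast
qed simp

text \<open>Breaking ties by index turns the lexicographic preorder into a linear order. This fixes
  the one admissible GALO list that the program follows.\<close>

definition before :: "(nat \<Rightarrow> real) \<Rightarrow> (nat \<Rightarrow> real) \<Rightarrow> nat \<Rightarrow> nat \<Rightarrow> bool" where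
  "before a b i j \<longleftrightarrow> lex_ge a b i j \<and> (lex_ge a b j i \<longrightarrow> i \<le> j)"

lemma ex_sorted_before:
  "\<exists>xs. distinct xs \<and> set xs = {..<n} \<and> sorted_wrt (before a b) xs"
proof (rule ex_sorted_wrt)
  fix i j k
  show "before a b i j \<or> before a b j i"
    using lex_ge_total[of a b i j] nat_le_linear[of i j] unfolding before_def by blast
  assume "before a b i j" "before a b j k"
  then have "lex_ge a b i j" "lex_ge a b j k" "lex_ge a b j i \<Longrightarrow> i \<le> j"
    "lex_ge a b k j \<Longrightarrow> j \<le> k" by (simp_all add: before_def)
  then show "before a b i k"
    unfolding before_def
    using lex_ge_trans[of a b i j k] lex_ge_trans[of a b j k i] lex_ge_trans[of a b k i j]
      le_trans[of i j k] by blast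
qed simp

lemma best_cong:
  assumes "\<And>i. i < n \<Longrightarrow> G i \<longleftrightarrow> G' i" "\<And>i. i < n \<Longrightarrow> x i = x' i" "\<And>i. i < n \<Longrightarrow> y i = y' i"
  shows "best n G x y q \<longleftrightarrow> best n G' x' y' q"
proof (cases q)
  case (Suc m)
  then show ?thesis
    by (simp add: assms lex_ge_def cong: conj_cong)
qed (simp add: assms)

lemma find_best:
  assumes xs: "set xs = {..<n}" "sorted_wrt (before a b) xs"
    and q: "best n (\<lambda>i. U i \<and> P i) a b q"
  shows "find P (filter U xs) = (case q of 0 \<Rightarrow> None | Suc m \<Rightarrow> Some m)"
proof (cases q)
  case 0
  then show ?thesis using q xs(1) by (auto simp: find_None_iff)
next
  case (Suc m)
  with q xs(1) have m: "m \<in> set (filter U xs)" "P m" by auto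
  then have "find P (filter U xs) \<noteq> None" unfolding find_None_iff by blast
  then obtain y where y: "find P (filter U xs) = Some y" by blast
  have "m = y \<or> before a b y m"
    using find_Some_first[OF y sorted_wrt_filter[OF xs(2)] m] .
  moreover have "before a b m y"
    using find_Some_in_set[OF y] q Suc xs(1) by (auto simp: before_def)
  ultimately have "m = y" unfolding before_def by fastforce
  then show ?thesis using Suc y by simp
qed

lemma remove1_filter:
  "distinct xs \<Longrightarrow> remove1 m (filter U xs) = filter (\<lambda>i. U i \<and> i \<noteq> m) xs"
  by (simp add: distinct_remove1_removeAll removeAll_filter_not_eq) (rule filter_cong, auto)

section \<open>Bipartite matchings and the exchange argument\<close>

definition adj :: "(nat \<Rightarrow> real) \<Rightarrow> (nat \<Rightarrow> real) \<Rightarrow> nat \<Rightarrow> nat \<Rightarrow> bool" where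
  "adj a b i j \<longleftrightarrow> a i + a j \<le> 1 \<and> b i + b j \<le> 1"

text \<open>A bipartite matching with its edges directed from \<open>X\<close> to \<open>Y\<close>.
  Directed pairs make the exchange below a matter of coordinates.\<close>

definition pairing ::
  "(nat \<Rightarrow> real) \<Rightarrow> (nat \<Rightarrow> real) \<Rightarrow> nat set \<Rightarrow> nat set \<Rightarrow> (nat \<times> nat) set \<Rightarrow> bool" where
  "pairing a b X Y N \<longleftrightarrow> finite N \<and> (\<forall>(i, j)\<in>N. i \<in> X \<and> j \<in> Y \<and> adj a b i j) \<and>
     inj_on fst N \<and> inj_on snd N"

lemma pairing_fst: "pairing a b X Y N \<Longrightarrow> (i, j) \<in> N \<Longrightarrow> (i, j') \<in> N \<Longrightarrow> j = j'"
  using inj_onD[of fst N "(i, j)" "(i, j')"] by (simp add: pairing_def)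

lemma pairing_snd: "pairing a b X Y N \<Longrightarrow> (i, j) \<in> N \<Longrightarrow> (i', j) \<in> N \<Longrightarrow> i = i'"
  using inj_onD[of snd N "(i, j)" "(i', j)"] by (simp add: pairing_def)

lemma pairingI:
  assumes "finite N" "\<And>i j. (i, j) \<in> N \<Longrightarrow> i \<in> X \<and> j \<in> Y \<and> adj a b i j"
    "\<And>i j j'. (i, j) \<in> N \<Longrightarrow> (i, j') \<in> N \<Longrightarrow> j = j'"
    "\<And>i i' j. (i, j) \<in> N \<Longrightarrow> (i', j) \<in> N \<Longrightarrow> i = i'"
  shows "pairing a b X Y N"
proof -
  have "inj_on fst N"
  proof (rule inj_onI)
    fix e f assume "e \<in> N" "f \<in> N" "fst e = fst f"
    then show "e = f" using assms(3)[of "fst e" "snd e" "snd f"] by (metis prod.collapse)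
  qed
  moreover have "inj_on snd N"
  proof (rule inj_onI)
    fix e f assume "e \<in> N" "f \<in> N" "snd e = snd f"
    then show "e = f" using assms(4)[of "fst e" "snd e" "fst f"] by (metis prod.collapse)
  qed
  ultimately show ?thesis using assms(1,2) unfolding pairing_def by blast
qed

lemma pairingD: "pairing a b X Y N \<Longrightarrow> (i, j) \<in> N \<Longrightarrow> i \<in> X \<and> j \<in> Y \<and> adj a b i j"
  by (auto simp: pairing_def)

lemma pairing_drop:
  assumes "pairing a b X Y N" "\<forall>j\<in>Y. \<not> adj a b i j"
  shows "pairing a b (X - {i}) Y N"
proof (rule pairingI)
  show "finite N" using assms(1) by (simp add: pairing_def)
  fix k l assume "(k, l) \<in> N"
  then show "k \<in> X - {i} \<and> l \<in> Y \<and> adj a b k l"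
    using pairingD[OF assms(1)] assms(2) by blast
qed (blast dest: pairing_fst[OF assms(1)] pairing_snd[OF assms(1)])+

text \<open>If \<open>i\<close> is paired with \<open>v\<close> and \<open>u\<close> with
  \<open>j\<close>, then \<open>u\<close> and \<open>v\<close> can be paired instead:
  \<open>a u + a v \<le> a i + a v \<le> 1\<close> and
  \<open>b u + b v \<le> b u + b j \<le> 1\<close>. Otherwise at most one pair touches
  \<open>i\<close> or \<open>j\<close>, and it is deleted. Either way one pair is lost.\<close>

lemma pairing_exchange:
  assumes N: "pairing a b X Y N" and i: "\<forall>u\<in>X. a u \<le> a i" "i \<in> X"
    and j: "\<forall>v\<in>Y. adj a b i v \<longrightarrow> b v \<le> b j" "j \<in> Y"
  shows "\<exists>N'. pairing a b (X - {i}) (Y - {j}) N' \<and> card N \<le> Suc (card N')"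
proof -
  define N1 where "N1 = {(u, v) \<in> N. u \<noteq> i \<and> v \<noteq> j}"
  have fin: "finite N" "finite N1" using N unfolding N1_def pairing_def
    by (auto intro: finite_subset[of _ N])
  have N1: "pairing a b (X - {i}) (Y - {j}) N1"
  proof (rule pairingI[OF fin(2)])
    fix k l assume "(k, l) \<in> N1"
    then show "k \<in> X - {i} \<and> l \<in> Y - {j} \<and> adj a b k l"
      using pairingD[OF N, of k l] by (simp add: N1_def)
  next
    fix k l l' assume "(k, l) \<in> N1" "(k, l') \<in> N1"
    then show "l = l'" using pairing_fst[OF N, of k l l'] by (simp add: N1_def)
  next
    fix k k' l assume "(k, l) \<in> N1" "(k', l) \<in> N1"
    then show "k = k'" using pairing_snd[OF N, of k l k'] by (simp add: N1_def)
  qed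
  show ?thesis
  proof (cases "\<exists>u v. u \<noteq> i \<and> v \<noteq> j \<and> (i, v) \<in> N \<and> (u, j) \<in> N")
    case True
    then obtain u v where uv: "u \<noteq> i" "v \<noteq> j" "(i, v) \<in> N" "(u, j) \<in> N" by blast
    have "adj a b i v" "adj a b u j" "u \<in> X" "v \<in> Y" using uv pairingD[OF N] by blast+
    moreover from this have "a u \<le> a i" "b v \<le> b j" using i(1) j(1) by auto
    ultimately have adj: "adj a b u v" unfolding adj_def by linarith
    have notin: "(u, w) \<notin> N1" "(w, v) \<notin> N1" for w
      using uv pairing_fst[OF N, of u w j] pairing_snd[OF N, of w v i] by (auto simp: N1_def)
    have "pairing a b (X - {i}) (Y - {j}) (insert (u, v) N1)"
    proof (rule pairingI)
      fix k l assume "(k, l) \<in> insert (u, v) N1"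
      then show "k \<in> X - {i} \<and> l \<in> Y - {j} \<and> adj a b k l"
        using adj uv \<open>u \<in> X\<close> \<open>v \<in> Y\<close> pairingD[OF N1, of k l] by auto
    next
      fix k l l' assume "(k, l) \<in> insert (u, v) N1" "(k, l') \<in> insert (u, v) N1"
      then show "l = l'" using notin pairing_fst[OF N1, of k l l'] by auto
    next
      fix k k' l assume "(k, l) \<in> insert (u, v) N1" "(k', l) \<in> insert (u, v) N1"
      then show "k = k'" using notin pairing_snd[OF N1, of k l k'] by auto
    qed (use fin in auto)
    moreover have "card N \<le> Suc (card (insert (u, v) N1))"
    proof -
      have "N \<subseteq> insert (i, v) (insert (u, j) N1)"
      proof
        fix e assume e: "e \<in> N"
        obtain k l where "e = (k, l)" by (cases e)
        then show "e \<in> insert (i, v) (insert (u, j) N1)"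
          using e uv pairing_fst[OF N, of i l v] pairing_snd[OF N, of k j u] by (auto simp: N1_def)
      qed
      then have "card N \<le> card (insert (i, v) (insert (u, j) N1))"
        using fin by (intro card_mono) auto
      also have "\<dots> \<le> Suc (Suc (card N1))"
        using fin by (simp add: card_insert_if)
      finally show ?thesis using notin fin by simp
    qed
    ultimately show ?thesis by blast
  next
    case False
    then have no: "\<not> (u \<noteq> i \<and> v \<noteq> j \<and> (i, v) \<in> N \<and> (u, j) \<in> N)" for u v by blast
    have "\<exists>e. N \<subseteq> insert e N1"
    proof (cases "N \<subseteq> N1")
      case F: False
      then obtain k l where kl: "(k, l) \<in> N" "k = i \<or> l = j" by (auto simp: N1_def)
      have "N \<subseteq> insert (k, l) N1"
      proof
        fix e assume e: "e \<in> N"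
        obtain k' l' where e': "e = (k', l')" by (cases e)
        show "e \<in> insert (k, l) N1"
        proof (rule ccontr)
          assume c: "e \<notin> insert (k, l) N1"
          then have kl': "k' = i \<or> l' = j" "(k', l') \<in> N" "(k', l') \<noteq> (k, l)"
            using e e' by (auto simp: N1_def)
          have "k \<noteq> k'"
          proof
            assume "k = k'"
            with pairing_fst[OF N kl(1), of l'] kl'(2,3) show False by simp
          qed
          moreover have "l \<noteq> l'"
          proof
            assume "l = l'"
            with pairing_snd[OF N kl(1), of k'] kl'(2,3) show False by simp
          qed
          ultimately show False
            using kl(2) kl'(1)
          proof (elim disjE)
            assume "k = i" "l' = j"
            with no[of k' l] kl(1) kl'(2) \<open>k \<noteq> k'\<close> \<open>l \<noteq> l'\<close> show False by simp
          next
            assume "l = j" "k' = i"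
            with no[of k l'] kl(1) kl'(2) \<open>k \<noteq> k'\<close> \<open>l \<noteq> l'\<close> show False by simp
          qed simp_all
        qed
      qed
      then show ?thesis by blast
    qed blast
    then obtain e where "N \<subseteq> insert e N1" by blast
    then have "card N \<le> card (insert e N1)" using fin by (intro card_mono) auto
    also have "\<dots> \<le> Suc (card N1)" using fin by (simp add: card_insert_if)
    finally show ?thesis using N1 by blast
  qed
qed

text \<open>An edge has exactly one end with \<open>a i > 1/2\<close>: two such ends overfill the
  first bin, and with none both second bars are big. So matchings are pairings, and the edges given
  by \<open>m\<close> can be counted at these ends.\<close>

lemma maximum_matching_if_pairings_le:
  assumes big: "\<forall>i<n. big a b i"
    and mate: "\<forall>i<n. m i < n \<and> m (m i) = i \<and> (m i \<noteq> i \<longrightarrow> adj a b i (m i))"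
    and opt: "\<forall>N. pairing a b {i. i < n \<and> a i > 1/2} {i. i < n \<and> \<not> a i > 1/2} N \<longrightarrow>
      card N \<le> card {i. i < n \<and> a i > 1/2 \<and> m i \<noteq> i}"
  shows "maximum_matching (chart_edges {..<n} a b) (edges_of_mates n m)"
proof -
  have types: "a i > 1/2 \<longleftrightarrow> \<not> a j > 1/2" if "i < n" "j < n" "a i + a j \<le> 1" "b i + b j \<le> 1" for i j
  proof -
    have "a i > 1/2 \<or> b i > 1/2" "a j > 1/2 \<or> b j > 1/2" using big that by (auto simp: big_def)
    then show ?thesis using that(3,4) by (elim disjE) linarith+
  qed
  have sub: "edges_of_mates n m \<subseteq> chart_edges {..<n} a b"
  proof
    fix e assume "e \<in> edges_of_mates n m"
    then obtain i where i: "e = {i, m i}" "i < n" "m i \<noteq> i" by (auto simp: edges_of_mates_def)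
    then have "m i < n" "adj a b i (m i)" using mate by blast+
    then show "e \<in> chart_edges {..<n} a b"
      using i unfolding chart_edges_def adj_def
      by (intro CollectI exI[of _ i] exI[of _ "m i"]) simp
  qed
  have disj: "pairwise disjnt (edges_of_mates n m)"
  proof (rule pairwiseI)
    have eq: "e = {x, m x}" if "e \<in> edges_of_mates n m" "x \<in> e" for e x
    proof -
      obtain i where i: "e = {i, m i}" "i < n" using \<open>e \<in> _\<close> by (auto simp: edges_of_mates_def)
      moreover have "m (m i) = i" using mate i(2) by blast
      moreover have "x = i \<or> x = m i" using \<open>x \<in> e\<close> i(1) by simp
      ultimately show ?thesis by (elim disjE) (simp_all add: insert_commute)
    qed
    fix e f assume e: "e \<in> edges_of_mates n m" "f \<in> edges_of_mates n m" "e \<noteq> f"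
    show "disjnt e f"
      unfolding disjnt_iff using eq[OF e(1)] eq[OF e(2)] e(3) by metis
  qed
  have fin: "finite (edges_of_mates n m)"
    by (rule finite_subset[of _ "(\<lambda>i. {i, m i}) ` {..<n}"]) (auto simp: edges_of_mates_def)
  have "inj_on (\<lambda>i. {i, m i}) {i. i < n \<and> a i > 1/2 \<and> m i \<noteq> i}"
  proof (rule inj_onI)
    fix i j assume ij: "i \<in> {i. i < n \<and> a i > 1/2 \<and> m i \<noteq> i}"
      "j \<in> {i. i < n \<and> a i > 1/2 \<and> m i \<noteq> i}" "{i, m i} = {j, m j}"
    then have "\<not> a (m i) > 1/2" using types[of i "m i"] mate unfolding adj_def by blast
    moreover have "i = j \<or> m i = j" using ij(3) by (simp add: doubleton_eq_iff) blast
    ultimately show "i = j" using ij(2) by blast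
  qed
  then have "card {i. i < n \<and> a i > 1/2 \<and> m i \<noteq> i} =
      card ((\<lambda>i. {i, m i}) ` {i. i < n \<and> a i > 1/2 \<and> m i \<noteq> i})"
    by (simp add: card_image)
  also have "\<dots> \<le> card (edges_of_mates n m)"
    using fin by (intro card_mono) (auto simp: edges_of_mates_def)
  finally have lower: "card {i. i < n \<and> a i > 1/2 \<and> m i \<noteq> i} \<le> card (edges_of_mates n m)" .
  have "card M \<le> card (edges_of_mates n m)" if M: "matching (chart_edges {..<n} a b) M" for M
  proof -
    define N where "N = {(i, j). {i, j} \<in> M \<and> i < n \<and> j < n \<and> a i > 1/2 \<and> \<not> a j > 1/2}"
    have edge: "\<exists>i j. e = {i, j} \<and> i < n \<and> j < n \<and> a i > 1/2 \<and> \<not> a j > 1/2 \<and> adj a b i j"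
      if "e \<in> M" for e
    proof -
      have "e \<in> chart_edges {..<n} a b" using M that by (auto simp: matching_def)
      then obtain i j where ij: "e = {i, j}" "i < n" "j < n" "a i + a j \<le> 1" "b i + b j \<le> 1"
        by (auto simp: chart_edges_def)
      show ?thesis
      proof (cases "a i > 1/2")
        case True
        then show ?thesis using ij types[OF ij(2-5)] by (auto simp: adj_def)
      next
        case False
        then have "a j > 1/2" using types[OF ij(2-5)] by blast
        then show ?thesis using ij False
          by (intro exI[of _ j] exI[of _ i]) (auto simp: adj_def insert_commute)
      qed
    qed
    have uniq: "e = f" if "e \<in> M" "f \<in> M" "x \<in> e" "x \<in> f" for e f x
      using M that unfolding matching_def pairwise_def disjnt_iff by blast
    have "finite N"
      by (rule finite_subset[of _ "{..<n} \<times> {..<n}"]) (auto simp: N_def)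
    have "pairing a b {i. i < n \<and> a i > 1/2} {i. i < n \<and> \<not> a i > 1/2} N"
    proof (rule pairingI[OF \<open>finite N\<close>])
      fix i j assume ij: "(i, j) \<in> N"
      then obtain i' j' where "{i, j} = {i', j'}" "adj a b i' j'"
        using edge[of "{i, j}"] by (auto simp: N_def)
      then have "adj a b i j" by (auto simp: doubleton_eq_iff adj_def add.commute)
      then show "i \<in> {i. i < n \<and> a i > 1/2} \<and> j \<in> {i. i < n \<and> \<not> a i > 1/2} \<and> adj a b i j"
        using ij by (auto simp: N_def)
    next
      fix i j j' assume "(i, j) \<in> N" "(i, j') \<in> N"
      then show "j = j'" using uniq[of "{i, j}" "{i, j'}" i] by (auto simp: N_def doubleton_eq_iff)
    next
      fix i i' j assume "(i, j) \<in> N" "(i', j) \<in> N"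
      then show "i = i'" using uniq[of "{i, j}" "{i', j}" j] by (auto simp: N_def doubleton_eq_iff)
    qed
    then have "card N \<le> card (edges_of_mates n m)" using opt lower by (meson le_trans)
    moreover have "M \<subseteq> (\<lambda>(i, j). {i, j}) ` N"
    proof
      fix e assume "e \<in> M"
      with edge[OF this] show "e \<in> (\<lambda>(i, j). {i, j}) ` N" by (force simp: N_def)
    qed
    then have "card M \<le> card N"
      using \<open>finite N\<close> by (meson card_image_le card_mono finite_imageI le_trans)
    ultimately show ?thesis by simp
  qed
  then show ?thesis using sub disj by (simp add: maximum_matching_def matching_def)
qed

section \<open>The program\<close>

definition length_com :: "vname \<Rightarrow> vname \<Rightarrow> vname \<Rightarrow> com" where
  "length_com p c l = Seq
     (For ''i'' (V ''n'') (Seq (NAssign c (NRead p (V ''i'')) (NConst 1))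
        (NAssign c (NPlus (NRead p (V ''i'')) (NConst 1)) (NConst 1))))
     (For ''i'' (NPlus (V ''n'') (V ''n''))
        (NAssign l (NConst 0) (NPlus (V l) (NRead c (NPlus (V ''i'') (NConst 1))))))"

text \<open>The first loop marks the used bins in \<open>c\<close>, the second adds up the marks of
  bins 1 to \<open>2 n\<close>. The marks must start at 0, so each of the two packings gets an array
  of its own.\<close>

lemma runs_length_com:
  assumes n: "nmem s ''n'' 0 = n" and c: "nmem s c = (\<lambda>_. 0)" and l: "nmem s l 0 = 0"
    and d: "distinct [p, c, l, ''i'', ''n'']"
  shows "runs (length_com p c l) s (100 * n + 100) (\<lambda>s'. nmem s' l 0 = packing_length {..<n} (nmem s p))"
proof -
  let ?P = "nmem s p"
  define hit where "hit j k \<longleftrightarrow> (\<exists>i<j. ?P i = k \<or> Suc (?P i) = k)" for j k :: nat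
  have hit_0: "\<not> hit 0 m" and hit_Suc: "hit (Suc k) m \<longleftrightarrow> hit k m \<or> ?P k = m \<or> Suc (?P k) = m" for k m
    by (auto simp: hit_def less_Suc_eq)
  let ?J = "\<lambda>s'. nmem s' ''n'' 0 = n \<and> nmem s' p = ?P"
  let ?I1 = "\<lambda>j s'. ?J s' \<and> nmem s' l 0 = 0 \<and> nmem s' c = (\<lambda>k. if hit j k then 1 else 0)"
  let ?I2 = "\<lambda>j s'. ?J s' \<and> nmem s' l 0 = card {k \<in> {1..j}. hit n k} \<and>
    nmem s' c = (\<lambda>k. if hit n k then 1 else 0)"
  have "runs (length_com p c l) s
     ((n * ((5 + 7) + 2 + 12) + 2 + 9) + ((n + n) * (10 + 5 + 12) + 5 + 9)) (?I2 (n + n))"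
    unfolding length_com_def
  proof (rule runs_Seq, rule runs_conseq)
    show "runs (For ''i'' (V ''n'') (Seq (NAssign c (NRead p (V ''i'')) (NConst 1))
        (NAssign c (NPlus (NRead p (V ''i'')) (NConst 1)) (NConst 1)))) s
        (n * ((5 + 7) + ncost (V ''n'') + 12) + ncost (V ''n'') + 9) (?I1 n)"
    proof (rule runs_For[where Inv = ?I1 and N = "n"])
      fix k and s' :: store assume k: "k < n" "nmem s' ''i'' 0 = k" and I: "?I1 k s'"
      show "runs (Seq (NAssign c (NRead p (V ''i'')) (NConst 1))
        (NAssign c (NPlus (NRead p (V ''i'')) (NConst 1)) (NConst 1))) s' (5 + 7)
        (\<lambda>s'. ?I1 (Suc k) (nwrite ''i'' 0 (Suc k) s'))"
        using d k I by (intro runs_Seq runs_NAssign) (auto simp: fun_eq_iff hit_Suc)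
    qed (use n c l d in \<open>auto simp: hit_0\<close>)
  next
    fix s1 :: store assume I1: "?I1 n s1"
    have "runs (For ''i'' (NPlus (V ''n'') (V ''n''))
        (NAssign l (NConst 0) (NPlus (V l) (NRead c (NPlus (V ''i'') (NConst 1)))))) s1
        ((n + n) * (10 + ncost (NPlus (V ''n'') (V ''n'')) + 12) + ncost (NPlus (V ''n'') (V ''n'')) + 9)
        (?I2 (n + n))"
    proof (rule runs_For[where Inv = ?I2 and N = "n + n"])
      fix k and s' :: store assume k: "k < n + n" "nmem s' ''i'' 0 = k" and I: "?I2 k s'"
      have "{m \<in> {1..Suc k}. hit n m} =
          (if hit n (Suc k) then insert (Suc k) {m \<in> {1..k}. hit n m} else {m \<in> {1..k}. hit n m})"
        by (auto simp: le_Suc_eq)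
      then have "card {m \<in> {1..Suc k}. hit n m} =
          card {m \<in> {1..k}. hit n m} + (if hit n (Suc k) then 1 else 0)"
        by simp
      then show "runs (NAssign l (NConst 0) (NPlus (V l) (NRead c (NPlus (V ''i'') (NConst 1))))) s' 10
        (\<lambda>s'. ?I2 (Suc k) (nwrite ''i'' 0 (Suc k) s'))"
        using d k I by (intro runs_NAssign) auto
    qed (use I1 d in auto)
    then show "runs (For ''i'' (NPlus (V ''n'') (V ''n''))
        (NAssign l (NConst 0) (NPlus (V l) (NRead c (NPlus (V ''i'') (NConst 1)))))) s1
        ((n + n) * (10 + 5 + 12) + 5 + 9) (?I2 (n + n))"
      by (rule runs_conseq) auto
  qed simp
  moreover have "{k \<in> {1..n + n}. hit n k} =
     {k \<in> {1..2 * card {..<n}}. \<exists>i\<in>{..<n}. ?P i = k \<or> ?P i + 1 = k}"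
    by (auto simp: hit_def)
  ultimately show ?thesis
    by (elim runs_conseq) (simp_all add: packing_length_def)
qed

definition copy_com :: "vname \<Rightarrow> vname \<Rightarrow> com" where
  "copy_com x y = For ''i'' (V ''n'') (NAssign x (V ''i'') (NRead y (V ''i'')))"

lemma runs_copy_com:
  assumes n: "nmem s ''n'' 0 = n" and d: "distinct [x, y, ''i'', ''n'']"
  shows "runs (copy_com x y) s (100 * n + 100) (\<lambda>s'. \<forall>i<n. nmem s' x i = nmem s y i)"
proof -
  let ?I = "\<lambda>j s'. nmem s' ''n'' 0 = n \<and> nmem s' y = nmem s y \<and> (\<forall>i<j. nmem s' x i = nmem s y i)"
  have "runs (copy_com x y) s (n * (6 + ncost (V ''n'') + 12) + ncost (V ''n'') + 9) (?I n)"
    unfolding copy_com_def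
  proof (rule runs_For[where Inv = ?I and N = "n"])
    fix k and s' :: store assume "k < n" "nmem s' ''i'' 0 = k" "?I k s'"
    then show "runs (NAssign x (V ''i'') (NRead y (V ''i''))) s' 6
        (\<lambda>s'. ?I (Suc k) (nwrite ''i'' 0 (Suc k) s'))"
      using d by (intro runs_NAssign) (auto simp: less_Suc_eq)
  qed (use n d in auto)
  then show ?thesis by (rule runs_conseq) auto
qed

definition output_com :: com where
  "output_com = Seq (length_com ''pg'' ''og'' ''lg'') (Seq (length_com ''pm'' ''om'' ''lm'')
     (Branch (NLe (V ''lg'') (V ''lm'')) (copy_com ''pa'' ''pg'') (copy_com ''pa'' ''pm'')))"

text \<open>A pair starts in the odd bin \<open>2 * min i (mate i) + 1\<close>. As an unmatched
  chart is its own mate, the same formula gives it two bins of its own.\<close>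

definition pm_com :: com where
  "pm_com = For ''i'' (V ''n'') (Branch (NLe (NRead ''mate'' (V ''i'')) (V ''i''))
     (NAssign ''pm'' (V ''i'') (NPlus (NPlus (NRead ''mate'' (V ''i'')) (NRead ''mate'' (V ''i''))) (NConst 1)))
     (NAssign ''pm'' (V ''i'') (NPlus (NPlus (V ''i'') (V ''i'')) (NConst 1))))"

lemma runs_pm_com:
  assumes n: "nmem s ''n'' 0 = n"
  shows "runs pm_com s (100 * n + 100)
    (\<lambda>s'. \<forall>i<n. nmem s' ''pm'' i = 2 * min i (nmem s ''mate'' i) + 1)"
proof -
  let ?I = "\<lambda>j s'. nmem s' ''n'' 0 = n \<and> nmem s' ''mate'' = nmem s ''mate'' \<and>
     (\<forall>i<j. nmem s' ''pm'' i = 2 * min i (nmem s ''mate'' i) + 1)"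
  let ?c1 = "NAssign ''pm'' (V ''i'')
    (NPlus (NPlus (NRead ''mate'' (V ''i'')) (NRead ''mate'' (V ''i''))) (NConst 1))"
  let ?c2 = "NAssign ''pm'' (V ''i'') (NPlus (NPlus (V ''i'') (V ''i'')) (NConst 1))"
  let ?g = "NLe (NRead ''mate'' (V ''i'')) (V ''i'')"
  have "runs pm_com s (n * ((bcost ?g + 1 + 20) + ncost (V ''n'') + 12) + ncost (V ''n'') + 9) (?I n)"
    unfolding pm_com_def
  proof (rule runs_For[where Inv = ?I and N = "n"])
    fix k and s' :: store assume k: "k < n" "nmem s' ''i'' 0 = k" and I: "?I k s'"
    show "runs (Branch ?g ?c1 ?c2) s' (bcost ?g + 1 + 20)
        (\<lambda>s'. ?I (Suc k) (nwrite ''i'' 0 (Suc k) s'))"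
    proof (rule runs_Branch)
      assume "bval ?g s'"
      then show "runs ?c1 s' 20 (\<lambda>s'. ?I (Suc k) (nwrite ''i'' 0 (Suc k) s'))"
        using k I by (intro runs_NAssign) (auto simp: less_Suc_eq)
    next
      assume "\<not> bval ?g s'"
      then show "runs ?c2 s' 20 (\<lambda>s'. ?I (Suc k) (nwrite ''i'' 0 (Suc k) s'))"
        using k I by (intro runs_NAssign) (auto simp: less_Suc_eq)
    qed
  qed (use n in auto)
  then show ?thesis by (rule runs_conseq) auto
qed

section \<open>The GALO loop\<close>

definition galo_guard :: bexp where
  "galo_guard = BAnd (NLe (NRead ''used'' (V ''i'')) (NConst 0))
     (RLe (RPlus (RRead ''pb'' (NConst 0)) (RRead ''a'' (V ''i''))) (RConst 1))"

text \<open>\<open>pb\<close> holds the second bar of the chart in the preceding bin. The value 0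
  stands for no chart, and then every chart passes the test because \<open>a i \<le> 1\<close>. The
  counter starts at 0, so the current bin is \<open>k + 1\<close>.\<close>

definition galo_place :: com where
  "galo_place = Branch (NLe (NConst 1) (V ''q''))
     (Seq (NAssign ''pg'' (Vpred ''q'') (NPlus (V ''k'') (NConst 1)))
       (Seq (NAssign ''used'' (Vpred ''q'') (NConst 1))
         (RAssign ''pb'' (NConst 0) (RRead ''b'' (Vpred ''q'')))))
     (RAssign ''pb'' (NConst 0) (RConst 0))"

definition galo_com :: com where
  "galo_com = For ''k'' (NPlus (V ''n'') (V ''n'')) (Seq (Scan galo_guard ''a'' ''b'') galo_place)"

text \<open>Placing a chart lowers the first term by 2 and raises the flag by at most 1; skipping a
  bin clears the flag. The measure therefore drops in every bin, and \<open>n + n\<close> rounds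
  from the initial value \<open>2 n\<close> empty the list.\<close>

lemma galo_measure_step:
  assumes "distinct ys"
    and "ys = [] \<or> 2 * length ys + (if prev = None then 0 else 1) + k \<le> m"
    and "find (fits_after a b prev) ys = r"
  shows "case r of
      None \<Rightarrow> ys = [] \<or> 2 * length ys + (if None = None then 0 else 1) + Suc k \<le> m
    | Some y \<Rightarrow> remove1 y ys = [] \<or> 2 * length (remove1 y ys) + (if Some y = None then 0 else 1) + Suc k \<le> m"
proof (cases r)
  case None
  show ?thesis
  proof (cases "ys = []")
    case False
    then obtain x where "prev = Some x" using assms(3) None by (cases prev; cases ys) auto
    then show ?thesis using None False assms(2) by simp
  qed (simp add: None)
next
  case (Some y)
  then have "Suc (length (remove1 y ys)) = length ys"
    using find_Some_in_set[of "fits_after a b prev" ys y] assms(3) length_pos_if_in_set[of y ys]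
    by (simp add: length_remove1)
  then show ?thesis using Some assms(2) by (cases "ys = []") (auto split: if_splits)
qed

lemma galo_state_step:
  fixes P :: "nat \<Rightarrow> nat"
  assumes xs: "distinct xs" "set xs = {..<n}"
    and g: "\<forall>i<n. galo a b 1 None xs i = (if U i then galo a b (Suc k) prev (filter U xs) i else P i)"
    and f: "find (fits_after a b prev) (filter U xs) = Some y"
  shows "\<forall>i<n. galo a b 1 None xs i =
    (if U i \<and> i \<noteq> y then galo a b (Suc (Suc k)) (Some y) (filter (\<lambda>i. U i \<and> i \<noteq> y) xs) i
     else (P(y := Suc k)) i)"
proof (intro allI impI)
  fix i assume i: "i < n"
  have "U y" using find_Some_in_set[OF f] by simp
  then show "galo a b 1 None xs i =
    (if U i \<and> i \<noteq> y then galo a b (Suc (Suc k)) (Some y) (filter (\<lambda>i. U i \<and> i \<noteq> y) xs) i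
     else (P(y := Suc k)) i)"
    using g[rule_format, OF i] galo_find_Some[OF f] remove1_filter[OF xs(1), of y U]
    by (cases "i = y") simp_all
qed

lemma runs_galo_com:
  assumes n: "nmem s ''n'' 0 = n" and u: "nmem s ''used'' = (\<lambda>_. 0)"
    and pb: "rmem s ''pb'' 0 = 0"
    and ab: "\<forall>i<n. rmem s ''a'' i = a i \<and> rmem s ''b'' i = b i"
    and le: "\<forall>i<n. a i \<le> 1"
  shows "runs galo_com s ((n + n) * (scan_cost galo_guard n + 100) + 100)
    (\<lambda>s'. galo_packing {..<n} a b (nmem s' ''pg''))"
proof -
  obtain xs where xs: "distinct xs" "set xs = {..<n}" "sorted_wrt (before a b) xs"
    using ex_sorted_before[of n a b] by blast
  have "lex_list {..<n} a b xs"
    unfolding lex_list_def using xs(1,2) sorted_wrt_mono_rel[OF _ xs(3), of "lex_ge a b"]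
    by (simp add: before_def)
  define U where "U s i \<longleftrightarrow> nmem s ''used'' i = 0" for s :: store and i
  define ys where "ys s = filter (U s) xs" for s
  \<comment> \<open>The final packing equals the stored values on used charts and the remaining
    recursive call on the others. \<open>prev\<close> is quantified because the memory keeps only
    its second bar.\<close>
  define st where "st k s' \<longleftrightarrow> (\<exists>prev.
      (\<forall>i<n. galo a b 1 None xs i = (if U s' i then galo a b (Suc k) prev (ys s') i else nmem s' ''pg'' i)) \<and>
      rmem s' ''pb'' 0 = (case prev of None \<Rightarrow> 0 | Some x \<Rightarrow> b x) \<and>
      (ys s' = [] \<or> 2 * length (ys s') + (if prev = None then 0 else 1) + k \<le> n + n))" for k s'
  define fr where "fr s' \<longleftrightarrow> nmem s' ''n'' 0 = n \<and> rmem s' ''a'' = rmem s ''a'' \<and> rmem s' ''b'' = rmem s ''b''" for s' :: store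
  have "runs galo_com s ((n + n) * ((scan_cost galo_guard n + 40) + ncost (NPlus (V ''n'') (V ''n'')) + 12)
      + ncost (NPlus (V ''n'') (V ''n'')) + 9) (\<lambda>s'. st (n + n) s' \<and> fr s')"
    unfolding galo_com_def
  proof (rule runs_For[where N = "n + n" and Inv = "\<lambda>k s'. st k s' \<and> fr s'"])
    show "''k'' \<notin> nmods (Seq (Scan galo_guard ''a'' ''b'') galo_place)"
      by (simp add: Scan_def galo_place_def)
    show "nval (NPlus (V ''n'') (V ''n'')) s' = n + n" if "st k s' \<and> fr s'" for k s'
      using that by (simp add: fr_def)
    have "U (nwrite ''k'' 0 0 s) = (\<lambda>_. True)" by (simp add: U_def u fun_eq_iff)
    moreover have "length xs = n" using distinct_card[OF xs(1)] xs(2) by simp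
    ultimately show "st 0 (nwrite ''k'' 0 0 s) \<and> fr (nwrite ''k'' 0 0 s)"
      using n pb unfolding st_def by (intro conjI exI[of _ None]) (simp_all add: ys_def fr_def)
  next
    fix k and s1 :: store assume k: "k < n + n" "nmem s1 ''k'' 0 = k" and I: "st k s1 \<and> fr s1"
    then obtain prev where
      g: "\<forall>i<n. galo a b 1 None xs i = (if U s1 i then galo a b (Suc k) prev (ys s1) i else nmem s1 ''pg'' i)"
      and pb1: "rmem s1 ''pb'' 0 = (case prev of None \<Rightarrow> 0 | Some x \<Rightarrow> b x)"
      and me: "ys s1 = [] \<or> 2 * length (ys s1) + (if prev = None then 0 else 1) + k \<le> n + n"
      by (auto simp: st_def)
    let ?G = "\<lambda>i. U s1 i \<and> rmem s1 ''pb'' 0 + rmem s1 ''a'' i \<le> 1"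
    show "runs (Seq (Scan galo_guard ''a'' ''b'') galo_place) s1 (scan_cost galo_guard n + 40)
      (\<lambda>s'. st (Suc k) (nwrite ''k'' 0 (Suc k) s') \<and> fr (nwrite ''k'' 0 (Suc k) s'))"
    proof (rule runs_Seq, rule runs_conseq, rule runs_Scan[where G = ?G and n = n])
      fix s' :: store
      assume "\<forall>v. v \<notin> {''q'', ''i''} \<longrightarrow> nmem s' v = nmem s1 v" "rmem s' = rmem s1"
      then show "bval galo_guard s' \<longleftrightarrow> ?G (nmem s' ''i'' 0)"
        by (simp add: galo_guard_def U_def)
    next
      fix s2 :: store assume "best n ?G (rmem s1 ''a'') (rmem s1 ''b'') (nmem s2 ''q'' 0) \<and>
        (\<forall>v. v \<notin> {''q'', ''i''} \<longrightarrow> nmem s2 v = nmem s1 v) \<and> rmem s2 = rmem s1"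
      then have be: "best n ?G (rmem s1 ''a'') (rmem s1 ''b'') (nmem s2 ''q'' 0)"
        and m2: "nmem s2 ''k'' = nmem s1 ''k''" "nmem s2 ''n'' = nmem s1 ''n''"
          "nmem s2 ''used'' = nmem s1 ''used''" "nmem s2 ''pg'' = nmem s1 ''pg''"
        and r2: "rmem s2 = rmem s1" by simp_all
      have fits: "rmem s1 ''pb'' 0 + a i \<le> 1 \<longleftrightarrow> fits_after a b prev i" if "i < n" for i
        using pb1 le that by (cases prev) auto
      have "best n (\<lambda>i. U s1 i \<and> fits_after a b prev i) a b (nmem s2 ''q'' 0)"
        using be by (rule best_cong[THEN iffD1, rotated 3]) (use I ab fits in \<open>simp_all add: fr_def\<close>)
      then have fi: "find (fits_after a b prev) (ys s1) =
          (case nmem s2 ''q'' 0 of 0 \<Rightarrow> None | Suc m \<Rightarrow> Some m)"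
        unfolding ys_def by (rule find_best[OF xs(2,3)])
      have dys: "distinct (ys s1)" using xs(1) by (simp add: ys_def)
      note me' = galo_measure_step[OF dys me fi]
      show "runs galo_place s2 40
        (\<lambda>s'. st (Suc k) (nwrite ''k'' 0 (Suc k) s') \<and> fr (nwrite ''k'' 0 (Suc k) s'))"
        unfolding galo_place_def
      proof (rule runs_conseq, rule runs_Branch[where B = 30])
        assume "bval (NLe (NConst 1) (V ''q'')) s2"
        then obtain y where y: "nmem s2 ''q'' 0 = Suc y" by (cases "nmem s2 ''q'' 0") auto
        have fy: "find (fits_after a b prev) (filter (U s1) xs) = Some y"
          using fi y by (simp add: ys_def)
        then have yn: "y < n" using find_Some_in_set[OF fy] xs(2) by auto
        note g' = galo_state_step[OF xs(1,2) g[unfolded ys_def] fy]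
        let ?s3 = "rwrite ''pb'' 0 (rmem s2 ''b'' y) (nwrite ''used'' y 1 (nwrite ''pg'' y (Suc k) s2))"
        let ?s4 = "nwrite ''k'' 0 (Suc k) ?s3"
        have U4: "U ?s4 = (\<lambda>i. U s1 i \<and> i \<noteq> y)" using m2 by (auto simp: U_def fun_eq_iff)
        have ys4: "ys ?s4 = filter (\<lambda>i. U s1 i \<and> i \<noteq> y) xs" unfolding ys_def U4 ..
        have "st (Suc k) ?s4"
          unfolding st_def ys4 U4
        proof (intro exI[of _ "Some y"] conjI)
          show "\<forall>i<n. galo a b 1 None xs i =
            (if U s1 i \<and> i \<noteq> y then galo a b (Suc (Suc k)) (Some y) (filter (\<lambda>i. U s1 i \<and> i \<noteq> y) xs) i
             else nmem ?s4 ''pg'' i)"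
            using g' m2 by simp
          show "rmem ?s4 ''pb'' 0 = (case Some y of None \<Rightarrow> 0 | Some x \<Rightarrow> b x)"
            using I ab yn r2 by (simp add: fr_def)
          show "filter (\<lambda>i. U s1 i \<and> i \<noteq> y) xs = [] \<or>
            2 * length (filter (\<lambda>i. U s1 i \<and> i \<noteq> y) xs) + (if Some y = None then 0 else 1) + Suc k \<le> n + n"
            using me' unfolding y ys_def remove1_filter[OF xs(1)] by simp
        qed
        moreover have "fr ?s4" using I r2 m2 by (simp add: fr_def)
        ultimately show "runs (Seq (NAssign ''pg'' (Vpred ''q'') (NPlus (V ''k'') (NConst 1)))
           (Seq (NAssign ''used'' (Vpred ''q'') (NConst 1))
             (RAssign ''pb'' (NConst 0) (RRead ''b'' (Vpred ''q''))))) s2 30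
          (\<lambda>s'. st (Suc k) (nwrite ''k'' 0 (Suc k) s') \<and> fr (nwrite ''k'' 0 (Suc k) s'))"
          using y m2 k(2)
          by (intro runs_Seq[where B = 10 and B' = 20, simplified] runs_Seq[where B = 10 and B' = 10, simplified]
              runs_NAssign runs_RAssign) simp_all
      next
        assume "\<not> bval (NLe (NConst 1) (V ''q'')) s2"
        then have q: "nmem s2 ''q'' 0 = 0" by simp
        let ?s4 = "nwrite ''k'' 0 (Suc k) (rwrite ''pb'' 0 0 s2)"
        have U4: "U ?s4 = U s1" using m2 by (auto simp: U_def fun_eq_iff)
        have ys4: "ys ?s4 = ys s1" unfolding ys_def U4 ..
        have "galo a b (Suc k) prev (ys s1) = galo a b (Suc (Suc k)) None (ys s1)"
          using fi q by (intro galo_find_None) simp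
        then have "st (Suc k) ?s4"
          unfolding st_def ys4 U4 using g m2 me' q by (intro exI[of _ None]) simp
        moreover have "fr ?s4" using I r2 m2 by (simp add: fr_def)
        ultimately show "runs (RAssign ''pb'' (NConst 0) (RConst 0)) s2 30
          (\<lambda>s'. st (Suc k) (nwrite ''k'' 0 (Suc k) s') \<and> fr (nwrite ''k'' 0 (Suc k) s'))"
          by (intro runs_RAssign) simp_all
      qed simp_all
    qed (use I in \<open>simp_all add: fr_def\<close>)
  qed
  then show ?thesis
  proof (rule runs_conseq)
    fix s' assume "st (n + n) s' \<and> fr s'"
    then obtain prev where
      g: "\<forall>i<n. galo a b 1 None xs i = (if U s' i then galo a b (Suc (n + n)) prev (ys s') i else nmem s' ''pg'' i)"
      and me: "ys s' = [] \<or> 2 * length (ys s') + (if prev = None then 0 else 1) + (n + n) \<le> n + n"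
      by (auto simp: st_def)
    have "ys s' = []" using me by auto
    then have "\<not> U s' i" if "i < n" for i
      using that xs(2) by (auto simp: ys_def filter_empty_conv)
    then show "galo_packing {..<n} a b (nmem s' ''pg'')"
      using g \<open>lex_list {..<n} a b xs\<close> by (auto simp: galo_packing_def)
  qed (simp add: algebra_simps)
qed

text \<open>\<open>F\<close> marks the free charts. The last conjunct is the optimality invariant:
  the pairs already fixed can be completed, using free charts only, to at least the size of any
  pairing. The first conjunct ensures that no free chart with a big first bar is left after
  \<open>n\<close> rounds.\<close>

definition match_inv ::
  "nat \<Rightarrow> (nat \<Rightarrow> real) \<Rightarrow> (nat \<Rightarrow> real) \<Rightarrow> nat \<Rightarrow> (nat \<Rightarrow> bool) \<Rightarrow> (nat \<Rightarrow> nat) \<Rightarrow> bool" where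
  "match_inv n a b k F m \<longleftrightarrow>
     card {i. i < n \<and> a i > 1/2 \<and> F i} \<le> n - k \<and>
     (\<forall>i<n. m i < n \<and> m (m i) = i \<and> (m i \<noteq> i \<longrightarrow> adj a b i (m i) \<and> \<not> F i)) \<and>
     (\<forall>N. pairing a b {i. i < n \<and> a i > 1/2} {i. i < n \<and> \<not> a i > 1/2} N \<longrightarrow>
       (\<exists>N'. pairing a b {i. i < n \<and> a i > 1/2 \<and> F i} {i. i < n \<and> \<not> a i > 1/2 \<and> F i} N' \<and>
         card N \<le> card {i. i < n \<and> a i > 1/2 \<and> m i \<noteq> i} + card N'))"

lemma match_inv_init: "match_inv n a b 0 (\<lambda>_. True) (\<lambda>i. i)"
proof -
  have "card {i. i < n \<and> a i > 1/2} \<le> card {..<n}" by (intro card_mono) auto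
  then show ?thesis by (auto simp: match_inv_def)
qed

lemma match_inv_done:
  assumes "match_inv n a b n F m" "\<forall>i<n. big a b i"
  shows "maximum_matching (chart_edges {..<n} a b) (edges_of_mates n m)"
proof (rule maximum_matching_if_pairings_le[OF assms(2)])
  show "\<forall>i<n. m i < n \<and> m (m i) = i \<and> (m i \<noteq> i \<longrightarrow> adj a b i (m i))"
    using assms(1) by (auto simp: match_inv_def)
  have "finite {i. i < n \<and> a i > 1/2 \<and> F i}" by simp
  then have e: "{i. i < n \<and> a i > 1/2 \<and> F i} = {}" using assms(1) unfolding match_inv_def by simp
  show "\<forall>N. pairing a b {i. i < n \<and> a i > 1/2} {i. i < n \<and> \<not> a i > 1/2} N \<longrightarrow>
      card N \<le> card {i. i < n \<and> a i > 1/2 \<and> m i \<noteq> i}"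
  proof (intro allI impI)
    fix N assume "pairing a b {i. i < n \<and> a i > 1/2} {i. i < n \<and> \<not> a i > 1/2} N"
    then obtain N' where N': "pairing a b {} {i. i < n \<and> \<not> a i > 1/2 \<and> F i} N'"
      "card N \<le> card {i. i < n \<and> a i > 1/2 \<and> m i \<noteq> i} + card N'"
      using assms(1) unfolding match_inv_def e by blast
    have "N' = {}" using pairingD[OF N'(1)] by auto
    then show "card N \<le> card {i. i < n \<and> a i > 1/2 \<and> m i \<noteq> i}" using N'(2) by simp
  qed
qed

text \<open>Once the charts with big first bar are used up, the remaining rounds of the loop are
  idle.\<close>

lemma match_inv_no_head:
  assumes "match_inv n a b k F m" "\<forall>i<n. \<not> (F i \<and> a i > 1/2)"
  shows "match_inv n a b (Suc k) F m"
proof -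
  have "{i. i < n \<and> a i > 1/2 \<and> F i} = {}" using assms(2) by blast
  then have "card {i. i < n \<and> a i > 1/2 \<and> F i} \<le> n - Suc k" by (simp only: card.empty le0)
  then show ?thesis using assms(1) unfolding match_inv_def by blast
qed

lemma match_inv_card_Suc:
  assumes "match_inv n a b k F m" "i < n" "a i > 1/2" "F i" "\<And>u. F' u \<Longrightarrow> F u" "\<not> F' i"
  shows "card {i. i < n \<and> a i > 1/2 \<and> F' i} \<le> n - Suc k"
proof -
  have "card {i. i < n \<and> a i > 1/2 \<and> F' i} \<le> card ({i. i < n \<and> a i > 1/2 \<and> F i} - {i})"
    using assms(5,6) by (intro card_mono) auto
  also have "\<dots> = card {i. i < n \<and> a i > 1/2 \<and> F i} - 1"
    using assms(2-4) by (intro card_Diff_singleton) simp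
  also have "\<dots> \<le> n - k - 1"
    using assms(1) unfolding match_inv_def by (intro diff_le_mono) blast
  finally show ?thesis by simp
qed

lemma match_inv_drop:
  assumes inv: "match_inv n a b k F m" and i: "i < n" "a i > 1/2" "F i"
    and no: "\<forall>j<n. F j \<and> \<not> a j > 1/2 \<longrightarrow> \<not> adj a b i j"
  shows "match_inv n a b (Suc k) (\<lambda>u. F u \<and> u \<noteq> i) m"
proof -
  let ?F = "\<lambda>u. F u \<and> u \<noteq> i"
  have sets: "{u. u < n \<and> a u > 1/2 \<and> ?F u} = {u. u < n \<and> a u > 1/2 \<and> F u} - {i}"
    "{u. u < n \<and> \<not> a u > 1/2 \<and> ?F u} = {u. u < n \<and> \<not> a u > 1/2 \<and> F u}"
    using i by auto
  have "card {i. i < n \<and> a i > 1/2 \<and> ?F i} \<le> n - Suc k"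
    by (rule match_inv_card_Suc[OF inv i]) auto
  moreover have "\<exists>N'. pairing a b {u. u < n \<and> a u > 1/2 \<and> ?F u} {u. u < n \<and> \<not> a u > 1/2 \<and> ?F u} N' \<and>
         card N \<le> card {i. i < n \<and> a i > 1/2 \<and> m i \<noteq> i} + card N'"
    if N: "pairing a b {i. i < n \<and> a i > 1/2} {i. i < n \<and> \<not> a i > 1/2} N" for N
  proof -
    obtain N' where N': "pairing a b {i. i < n \<and> a i > 1/2 \<and> F i} {i. i < n \<and> \<not> a i > 1/2 \<and> F i} N'"
      "card N \<le> card {i. i < n \<and> a i > 1/2 \<and> m i \<noteq> i} + card N'"
      using inv N unfolding match_inv_def by blast
    have "pairing a b ({u. u < n \<and> a u > 1/2 \<and> F u} - {i}) {u. u < n \<and> \<not> a u > 1/2 \<and> F u} N'"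
      using no by (intro pairing_drop[OF N'(1)]) auto
    then show ?thesis using N'(2) unfolding sets by blast
  qed
  moreover have "\<forall>i<n. m i < n \<and> m (m i) = i \<and> (m i \<noteq> i \<longrightarrow> adj a b i (m i) \<and> \<not> ?F i)"
    using inv unfolding match_inv_def by blast
  ultimately show ?thesis unfolding match_inv_def by blast
qed

text \<open>By the exchange lemma, removing \<open>i\<close> and \<open>j\<close> costs a pairing of
  the free charts at most one pair, and the new mates make up for it.\<close>

lemma match_inv_pair:
  assumes inv: "match_inv n a b k F m" and i: "i < n" "a i > 1/2" "F i"
    and imax: "\<forall>u<n. F u \<and> a u > 1/2 \<longrightarrow> a u \<le> a i"
    and j: "j < n" "\<not> a j > 1/2" "F j" "adj a b i j"
    and jmax: "\<forall>v<n. F v \<and> \<not> a v > 1/2 \<and> adj a b i v \<longrightarrow> b v \<le> b j"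
  shows "match_inv n a b (Suc k) (\<lambda>u. F u \<and> u \<noteq> i \<and> u \<noteq> j) (m(i := j, j := i))"
proof -
  let ?F = "\<lambda>u. F u \<and> u \<noteq> i \<and> u \<noteq> j" and ?m = "m(i := j, j := i)"
  have ij: "i \<noteq> j" using i(2) j(2) by auto
  have sets: "{u. u < n \<and> a u > 1/2 \<and> ?F u} = {u. u < n \<and> a u > 1/2 \<and> F u} - {i}"
    "{u. u < n \<and> \<not> a u > 1/2 \<and> ?F u} = {u. u < n \<and> \<not> a u > 1/2 \<and> F u} - {j}"
    using i(2) j(2) by auto
  have m: "m u < n" "m (m u) = u" "m u \<noteq> u \<Longrightarrow> adj a b u (m u)" "m u \<noteq> u \<Longrightarrow> \<not> F u"
    if "u < n" for u using inv that unfolding match_inv_def by blast+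
  have mij: "m i = i" "m j = j" using m(4) i j by blast+
  have "{u. u < n \<and> a u > 1/2 \<and> ?m u \<noteq> u} = insert i {u. u < n \<and> a u > 1/2 \<and> m u \<noteq> u}"
    using i j(2) ij by auto
  moreover have "i \<notin> {u. u < n \<and> a u > 1/2 \<and> m u \<noteq> u}" using mij by simp
  ultimately have card_m: "card {u. u < n \<and> a u > 1/2 \<and> ?m u \<noteq> u} =
      Suc (card {u. u < n \<and> a u > 1/2 \<and> m u \<noteq> u})" by simp
  have "card {i. i < n \<and> a i > 1/2 \<and> ?F i} \<le> n - Suc k"
    by (rule match_inv_card_Suc[OF inv i]) auto
  moreover have "\<exists>N'. pairing a b {u. u < n \<and> a u > 1/2 \<and> ?F u} {u. u < n \<and> \<not> a u > 1/2 \<and> ?F u} N' \<and>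
         card N \<le> card {i. i < n \<and> a i > 1/2 \<and> ?m i \<noteq> i} + card N'"
    if N: "pairing a b {i. i < n \<and> a i > 1/2} {i. i < n \<and> \<not> a i > 1/2} N" for N
  proof -
    obtain N1 where N1: "pairing a b {i. i < n \<and> a i > 1/2 \<and> F i} {i. i < n \<and> \<not> a i > 1/2 \<and> F i} N1"
      "card N \<le> card {i. i < n \<and> a i > 1/2 \<and> m i \<noteq> i} + card N1"
      using inv N unfolding match_inv_def by blast
    have "\<exists>N'. pairing a b ({u. u < n \<and> a u > 1/2 \<and> F u} - {i}) ({u. u < n \<and> \<not> a u > 1/2 \<and> F u} - {j}) N' \<and>
      card N1 \<le> Suc (card N')"
      by (rule pairing_exchange[OF N1(1)]) (use imax i jmax j in auto)
    then obtain N' where "pairing a b ({u. u < n \<and> a u > 1/2 \<and> F u} - {i}) ({u. u < n \<and> \<not> a u > 1/2 \<and> F u} - {j}) N'"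
      "card N1 \<le> Suc (card N')" by blast
    then show ?thesis using N1(2) unfolding sets card_m by (intro exI[of _ N']) simp
  qed
  moreover have "?m u < n \<and> ?m (?m u) = u \<and> (?m u \<noteq> u \<longrightarrow> adj a b u (?m u) \<and> \<not> ?F u)" if u: "u < n" for u
  proof -
    consider "u = i" | "u = j" | "u \<noteq> i" "u \<noteq> j" by blast
    then show ?thesis
    proof cases
      case 1
      then show ?thesis using ij i(1) j(1,4) by simp
    next
      case 2
      moreover have "adj a b j i" using j(4) by (simp add: adj_def add.commute)
      ultimately show ?thesis using ij i(1) j(1) by simp
    next
      case 3
      have "m u \<noteq> i" "m u \<noteq> j" using m(2)[OF u] mij 3 by metis+
      then show ?thesis using 3 m[OF u] by simp
    qed
  qed
  ultimately show ?thesis unfolding match_inv_def by blast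
qed

text \<open>The comparison with 1/2 is made as \<open>a i + a i \<le> 1\<close>, because program
  constants are natural numbers.\<close>

definition head_guard :: bexp where
  "head_guard = BAnd (NLe (NRead ''done'' (V ''i'')) (NConst 0))
     (BNot (RLe (RPlus (RRead ''a'' (V ''i'')) (RRead ''a'' (V ''i''))) (RConst 1)))"

definition mate_guard :: bexp where
  "mate_guard = BAnd (NLe (NRead ''done'' (V ''i'')) (NConst 0))
     (BAnd (RLe (RPlus (RRead ''a'' (V ''i'')) (RRead ''a'' (V ''i''))) (RConst 1))
       (BAnd (RLe (RPlus (RRead ''a'' (Vpred ''h'')) (RRead ''a'' (V ''i''))) (RConst 1))
         (RLe (RPlus (RRead ''b'' (Vpred ''h'')) (RRead ''b'' (V ''i''))) (RConst 1))))"

definition pair_com :: com where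
  "pair_com = Branch (NLe (NConst 1) (V ''q''))
     (Seq (NAssign ''done'' (Vpred ''q'') (NConst 1))
       (Seq (NAssign ''mate'' (Vpred ''h'') (Vpred ''q''))
         (NAssign ''mate'' (Vpred ''q'') (Vpred ''h''))))
     Skip"

text \<open>The chosen chart is saved in \<open>h\<close> since the second scan overwrites
  \<open>q\<close>. It is marked as done whether or not a mate is found. The second scan compares
  second bars before first bars.\<close>

definition head_com :: com where
  "head_com = Seq (NAssign ''h'' (NConst 0) (V ''q''))
     (Branch (NLe (NConst 1) (V ''h''))
       (Seq (NAssign ''done'' (Vpred ''h'') (NConst 1)) (Seq (Scan mate_guard ''b'' ''a'') pair_com))
       Skip)"

definition match_com :: com where
  "match_com = Seq
     (For ''k'' (V ''n'') (NAssign ''mate'' (V ''k'') (V ''k'')))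
     (For ''k'' (V ''n'') (Seq (Scan head_guard ''a'' ''b'') head_com))"

lemma match_inv_mate_cong:
  assumes "match_inv n a b k F m" "\<And>i. i < n \<Longrightarrow> m i = m' i"
  shows "match_inv n a b k F m'"
proof -
  have "{i. i < n \<and> a i > 1/2 \<and> m i \<noteq> i} = {i. i < n \<and> a i > 1/2 \<and> m' i \<noteq> i}"
    using assms(2) by auto
  moreover have "\<forall>i<n. m' i < n \<and> m' (m' i) = i \<and> (m' i \<noteq> i \<longrightarrow> adj a b i (m' i) \<and> \<not> F i)"
    using assms unfolding match_inv_def by metis
  ultimately show ?thesis using assms(1) unfolding match_inv_def by simp
qed

lemma runs_match_com:
  assumes n: "nmem s ''n'' 0 = n" and d: "nmem s ''done'' = (\<lambda>_. 0)"
    and ab: "\<forall>i<n. rmem s ''a'' i = a i \<and> rmem s ''b'' i = b i"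
    and big: "\<forall>i<n. big a b i"
  shows "runs match_com s (n * (scan_cost head_guard n + scan_cost mate_guard n + 200) + 100 * n + 100)
    (\<lambda>s'. match_inv n a b n (\<lambda>i. nmem s' ''done'' i = 0) (nmem s' ''mate''))"
proof -
  define st where "st k s' \<longleftrightarrow> match_inv n a b k (\<lambda>i. nmem s' ''done'' i = 0) (nmem s' ''mate'')"
    for k and s' :: store
  define fr where "fr s' \<longleftrightarrow> nmem s' ''n'' 0 = n \<and> rmem s' = rmem s" for s' :: store
  let ?I1 = "\<lambda>k s'. fr s' \<and> nmem s' ''done'' = (\<lambda>_. 0) \<and> (\<forall>i<k. nmem s' ''mate'' i = i)"
  have "runs match_com s ((n * (5 + ncost (V ''n'') + 12) + ncost (V ''n'') + 9) +
     (n * ((scan_cost head_guard n + (5 + (5 + (6 + (scan_cost mate_guard n + 40))))) + ncost (V ''n'') + 12)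
      + ncost (V ''n'') + 9)) (\<lambda>s'. st n s' \<and> fr s')"
    unfolding match_com_def
  proof (rule runs_Seq, rule runs_conseq)
    show "runs (For ''k'' (V ''n'') (NAssign ''mate'' (V ''k'') (V ''k''))) s
      (n * (5 + ncost (V ''n'') + 12) + ncost (V ''n'') + 9) (?I1 n)"
    proof (rule runs_For[where Inv = ?I1 and N = n])
      fix k and s' :: store assume "k < n" "nmem s' ''k'' 0 = k" "?I1 k s'"
      then show "runs (NAssign ''mate'' (V ''k'') (V ''k'')) s' 5 (\<lambda>s'. ?I1 (Suc k) (nwrite ''k'' 0 (Suc k) s'))"
        by (intro runs_NAssign) (auto simp: fr_def less_Suc_eq)
    qed (use n d in \<open>auto simp: fr_def\<close>)
  next
    fix s0 :: store assume s0: "?I1 n s0"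
    show "runs (For ''k'' (V ''n'') (Seq (Scan head_guard ''a'' ''b'') head_com)) s0
     (n * ((scan_cost head_guard n + (5 + (5 + (6 + (scan_cost mate_guard n + 40))))) + ncost (V ''n'') + 12)
      + ncost (V ''n'') + 9) (\<lambda>s'. st n s' \<and> fr s')"
    proof (rule runs_For[where N = n and Inv = "\<lambda>k s'. st k s' \<and> fr s'"])
      show "''k'' \<notin> nmods (Seq (Scan head_guard ''a'' ''b'') head_com)"
        by (simp add: Scan_def head_com_def pair_com_def)
      show "nval (V ''n'') s' = n" if "st k s' \<and> fr s'" for k s'
        using that by (simp add: fr_def)
      have "match_inv n a b 0 (\<lambda>_. True) (nmem s0 ''mate'')"
        using s0 by (intro match_inv_mate_cong[OF match_inv_init]) simp
      then show "st 0 (nwrite ''k'' 0 0 s0) \<and> fr (nwrite ''k'' 0 0 s0)"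
        using s0 by (simp add: st_def fr_def)
    next
      fix k and s1 :: store assume k: "k < n" "nmem s1 ''k'' 0 = k" and I: "st k s1 \<and> fr s1"
      let ?F = "\<lambda>i. nmem s1 ''done'' i = 0" and ?m = "nmem s1 ''mate''"
      have inv: "match_inv n a b k ?F ?m" using I by (simp add: st_def)
      have r1: "rmem s1 = rmem s" and n1: "nmem s1 ''n'' 0 = n" using I by (simp_all add: fr_def)
      let ?Q = "\<lambda>s'. st (Suc k) (nwrite ''k'' 0 (Suc k) s') \<and> fr (nwrite ''k'' 0 (Suc k) s')"
      let ?G = "\<lambda>i. ?F i \<and> \<not> rmem s ''a'' i + rmem s ''a'' i \<le> 1"
      show "runs (Seq (Scan head_guard ''a'' ''b'') head_com) s1
        (scan_cost head_guard n + (5 + (5 + (6 + (scan_cost mate_guard n + 40))))) ?Q"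
      proof (rule runs_Seq, rule runs_conseq, rule runs_Scan[where G = ?G and n = n])
        fix s' :: store
        assume "\<forall>v. v \<notin> {''q'', ''i''} \<longrightarrow> nmem s' v = nmem s1 v" "rmem s' = rmem s1"
        then show "bval head_guard s' \<longleftrightarrow> ?G (nmem s' ''i'' 0)"
          by (simp add: head_guard_def r1)
      next
        fix s2 :: store assume "best n ?G (rmem s1 ''a'') (rmem s1 ''b'') (nmem s2 ''q'' 0) \<and>
          (\<forall>v. v \<notin> {''q'', ''i''} \<longrightarrow> nmem s2 v = nmem s1 v) \<and> rmem s2 = rmem s1"
        then have be0: "best n ?G (rmem s ''a'') (rmem s ''b'') (nmem s2 ''q'' 0)"
          and m2: "nmem s2 ''n'' = nmem s1 ''n''"
            "nmem s2 ''done'' = nmem s1 ''done''" "nmem s2 ''mate'' = nmem s1 ''mate''"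
          and r2: "rmem s2 = rmem s" using r1 by simp_all
        have be: "best n (\<lambda>i. ?F i \<and> a i > 1/2) a b (nmem s2 ''q'' 0)"
          using be0 by (rule best_cong[THEN iffD1, rotated 3]) (use ab in auto)
        show "runs head_com s2 (5 + (5 + (6 + (scan_cost mate_guard n + 40)))) ?Q"
          unfolding head_com_def
        proof (rule runs_Seq, rule runs_NAssign, rule runs_conseq,
            rule runs_Branch[where B = "6 + (scan_cost mate_guard n + 40)"])
          let ?s = "nwrite ''h'' (nval (NConst 0) s2) (nval (V ''q'') s2) s2"
          assume "\<not> bval (NLe (NConst 1) (V ''h'')) ?s"
          then have "nmem s2 ''q'' 0 = 0" by simp
          then have "match_inv n a b (Suc k) ?F ?m"
            using be by (intro match_inv_no_head[OF inv]) simp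
          then have "?Q ?s" using m2 r2 n1 by (simp add: st_def fr_def)
          then show "runs Skip ?s (6 + (scan_cost mate_guard n + 40)) ?Q"
            by (rule runs_Skip) simp
        next
          let ?s = "nwrite ''h'' (nval (NConst 0) s2) (nval (V ''q'') s2) s2"
          assume "bval (NLe (NConst 1) (V ''h'')) ?s"
          then obtain i where q: "nmem s2 ''q'' 0 = Suc i" by (cases "nmem s2 ''q'' 0") auto
          then have i: "i < n" "a i > 1/2" "?F i"
            and imax: "\<forall>u<n. ?F u \<and> a u > 1/2 \<longrightarrow> a u \<le> a i"
            using be by (auto simp: lex_ge_def)
          define s3 where "s3 = nwrite ''done'' i 1 ?s"
          have s3: "nmem s3 ''h'' 0 = Suc i" "nmem s3 ''done'' = (nmem s1 ''done'')(i := 1)"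
            "nmem s3 ''mate'' = ?m" "nmem s3 ''n'' 0 = n" "rmem s3 = rmem s"
            using q m2 r2 n1 by (simp_all add: s3_def)
          let ?H = "\<lambda>j. nmem s3 ''done'' j = 0 \<and> rmem s ''a'' j + rmem s ''a'' j \<le> 1 \<and>
            rmem s ''a'' i + rmem s ''a'' j \<le> 1 \<and> rmem s ''b'' i + rmem s ''b'' j \<le> 1"
          have "runs (Seq (Scan mate_guard ''b'' ''a'') pair_com) s3 (scan_cost mate_guard n + 40) ?Q"
          proof (rule runs_Seq, rule runs_conseq, rule runs_Scan[where G = ?H and n = n])
            fix s' :: store
            assume "\<forall>v. v \<notin> {''q'', ''i''} \<longrightarrow> nmem s' v = nmem s3 v" "rmem s' = rmem s3"
            then show "bval mate_guard s' \<longleftrightarrow> ?H (nmem s' ''i'' 0)"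
              using s3(1,5) by (simp add: mate_guard_def)
          next
            fix s4 :: store assume "best n ?H (rmem s3 ''b'') (rmem s3 ''a'') (nmem s4 ''q'' 0) \<and>
              (\<forall>v. v \<notin> {''q'', ''i''} \<longrightarrow> nmem s4 v = nmem s3 v) \<and> rmem s4 = rmem s3"
            then have be0: "best n ?H (rmem s ''b'') (rmem s ''a'') (nmem s4 ''q'' 0)"
              and m4: "nmem s4 ''h'' 0 = Suc i" "nmem s4 ''n'' 0 = n"
                "nmem s4 ''done'' = (nmem s1 ''done'')(i := 1)" "nmem s4 ''mate'' = ?m"
              and r4: "rmem s4 = rmem s" using s3 by simp_all
            have be: "best n (\<lambda>j. ?F j \<and> \<not> a j > 1/2 \<and> adj a b i j) b a (nmem s4 ''q'' 0)"
              using be0 by (rule best_cong[THEN iffD1, rotated 3]) (use ab i s3(2) in \<open>auto simp: adj_def\<close>)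
            show "runs pair_com s4 40 ?Q"
              unfolding pair_com_def
            proof (rule runs_conseq, rule runs_Branch[where B = 30])
              assume "\<not> bval (NLe (NConst 1) (V ''q'')) s4"
              then have "nmem s4 ''q'' 0 = 0" by simp
              then have "match_inv n a b (Suc k) (\<lambda>u. ?F u \<and> u \<noteq> i) ?m"
                using be by (intro match_inv_drop[OF inv i]) auto
              moreover have "(\<lambda>u. nmem s4 ''done'' u = 0) = (\<lambda>u. ?F u \<and> u \<noteq> i)"
                unfolding m4 by (auto simp: fun_eq_iff)
              ultimately have "?Q s4" using m4 r4 by (simp add: st_def fr_def)
              then show "runs Skip s4 30 ?Q" by (rule runs_Skip) simp
            next
              assume "bval (NLe (NConst 1) (V ''q'')) s4"
              then obtain j where q4: "nmem s4 ''q'' 0 = Suc j" by (cases "nmem s4 ''q'' 0") auto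
              then have j: "j < n" "\<not> a j > 1/2" "?F j" "adj a b i j"
                and jmax: "\<forall>v<n. ?F v \<and> \<not> a v > 1/2 \<and> adj a b i v \<longrightarrow> b v \<le> b j"
                using be by (auto simp: lex_ge_def)
              let ?s5 = "nwrite ''mate'' j i (nwrite ''mate'' i j (nwrite ''done'' j 1 s4))"
              have "match_inv n a b (Suc k) (\<lambda>u. ?F u \<and> u \<noteq> i \<and> u \<noteq> j) (?m(i := j, j := i))"
                by (rule match_inv_pair[OF inv i imax j jmax])
              moreover have "(\<lambda>u. nmem ?s5 ''done'' u = 0) = (\<lambda>u. ?F u \<and> u \<noteq> i \<and> u \<noteq> j)"
                using m4 by (auto simp: fun_eq_iff)
              moreover have "nmem ?s5 ''mate'' = ?m(i := j, j := i)" using m4 by simp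
              moreover have "fr (nwrite ''k'' 0 (Suc k) ?s5)" using m4 r4 by (simp add: fr_def)
              ultimately have Q5: "?Q ?s5" by (simp add: st_def)
              have "runs (Seq (NAssign ''done'' (Vpred ''q'') (NConst 1))
                 (Seq (NAssign ''mate'' (Vpred ''h'') (Vpred ''q''))
                   (NAssign ''mate'' (Vpred ''q'') (Vpred ''h'')))) s4 (10 + (10 + 10)) (\<lambda>s'. s' = ?s5)"
                using q4 m4 by (intro runs_Seq runs_NAssign) simp_all
              then show "runs (Seq (NAssign ''done'' (Vpred ''q'') (NConst 1))
                 (Seq (NAssign ''mate'' (Vpred ''h'') (Vpred ''q''))
                   (NAssign ''mate'' (Vpred ''q'') (Vpred ''h'')))) s4 30 ?Q"
                by (rule runs_conseq) (use Q5 in simp_all)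
            qed simp_all
          qed (use s3 in simp_all)
          then show "runs (Seq (NAssign ''done'' (Vpred ''h'') (NConst 1))
              (Seq (Scan mate_guard ''b'' ''a'') pair_com)) ?s (6 + (scan_cost mate_guard n + 40)) ?Q"
            using q by - (rule runs_Seq, rule runs_NAssign, simp_all add: s3_def)
        qed simp_all
      qed (use n1 in simp_all)
    qed
  qed simp
  then show ?thesis
    by (rule runs_conseq) (simp_all add: st_def algebra_simps)
qed

text \<open>All start bins are odd and a start bin belongs to one pair or one single chart. An odd
  bin thus holds only first bars, an even one only second bars, and adjacency bounds both.\<close>

lemma matching_packing_of_mates:
  assumes ch: "two_bar_charts {..<n} a b"
    and m: "\<forall>i<n. m i < n \<and> m (m i) = i \<and> (m i \<noteq> i \<longrightarrow> adj a b i (m i))"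
    and p: "\<forall>i<n. p i = 2 * min i (m i) + 1"
  shows "matching_packing {..<n} a b (edges_of_mates n m) p"
proof -
  have pm: "p (m i) = p i" if "i < n" for i using that m p by (simp add: min.commute)
  have same: "j = i \<or> j = m i" if "i < n" "j < n" "p i = p j" for i j
  proof -
    have "min i (m i) = min j (m j)" using p that by simp
    then have "i = j \<or> i = m j \<or> m i = j \<or> m i = m j" by (auto simp: min_def split: if_splits)
    then show ?thesis using m that by metis
  qed
  have st: "starts_in {..<n} p (p i) = {i, m i}" if "i < n" for i
  proof
    show "starts_in {..<n} p (p i) \<subseteq> {i, m i}"
    proof
      fix j assume "j \<in> starts_in {..<n} p (p i)"
      then have "j < n" "p i = p j" by (simp_all add: starts_in_def)
      from same[OF that this] show "j \<in> {i, m i}" by simp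
    qed
    show "{i, m i} \<subseteq> starts_in {..<n} p (p i)"
      using that m pm[OF that] by (simp add: starts_in_def)
  qed
  have le: "a i \<le> 1" "b i \<le> 1" if "i < n" for i
    using ch that by (auto simp: two_bar_charts_def)
  have sum_le: "(\<Sum>j\<in>{i, m i}. a j) \<le> 1" "(\<Sum>j\<in>{i, m i}. b j) \<le> 1" if "i < n" for i
    using le[OF that] m that by (cases "m i = i"; simp add: adj_def)+
  have none: "starts_in {..<n} p k = {} \<or> (\<exists>i<n. k = p i)" for k by (auto simp: starts_in_def)
  have odd: "odd (p i)" if "i < n" for i using p that by simp
  have "feasible {..<n} a b p"
    unfolding feasible_def
  proof (intro conjI ballI)
    show "p \<in> {..<n} \<rightarrow> {1..2 * card {..<n} - 1}" using p by fastforce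
    fix k assume k: "k \<in> {1..2 * card {..<n}}"
    show "(\<Sum>i\<in>starts_in {..<n} p k. a i) + (\<Sum>i\<in>starts_in {..<n} p (k - 1). b i) \<le> 1"
    proof (cases "odd k")
      case True
      then have "even (k - 1)" by simp
      then have "\<not> (\<exists>i<n. k - 1 = p i)" using odd by metis
      then have "starts_in {..<n} p (k - 1) = {}" using none[of "k - 1"] by blast
      then show ?thesis using none[of k] st sum_le(1) by auto
    next
      case False
      then have "\<not> (\<exists>i<n. k = p i)" using odd by blast
      then have "starts_in {..<n} p k = {}" using none[of k] by blast
      then show ?thesis using none[of "k - 1"] st sum_le(2) by auto
    qed
  qed
  moreover have "p i = p j" if e: "{i, j} \<in> edges_of_mates n m" for i j
  proof -
    obtain u where "{i, j} = {u, m u}" "u < n" using e by (auto simp: edges_of_mates_def)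
    then show ?thesis using pm[of u] by (auto simp: doubleton_eq_iff)
  qed
  ultimately show ?thesis by (simp add: matching_packing_def)
qed

section \<open>The assembled program and its cost\<close>

definition app_com :: com where
  "app_com = Seq match_com (Seq galo_com (Seq pm_com output_com))"

definition app_cost :: "nat \<Rightarrow> nat" where
  "app_cost n =
     (n * (scan_cost head_guard n + scan_cost mate_guard n + 200) + 100 * n + 100) +
     (((n + n) * (scan_cost galo_guard n + 100) + 100) +
     ((100 * n + 100) + ((100 * n + 100) + ((100 * n + 100) + (5 + 1 + (100 * n + 100))))))"

lemma mods:
  "nmods (Scan g x y) = {''q'', ''i''}" "rmods (Scan g x y) = {}"
  "nmods match_com = {''k'', ''mate'', ''q'', ''i'', ''h'', ''done''}" "rmods match_com = {}"
  "nmods galo_com = {''k'', ''q'', ''i'', ''pg'', ''used''}" "rmods galo_com = {''pb''}"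
  "nmods pm_com = {''i'', ''pm''}" "rmods pm_com = {}"
  "nmods (length_com p c l) = {''i'', c, l}" "rmods (length_com p c l) = {}"
  "nmods (copy_com x y) = {''i'', x}" "rmods (copy_com x y) = {}"
  by (auto simp: Scan_def match_com_def head_com_def pair_com_def galo_com_def galo_place_def
      pm_com_def length_com_def copy_com_def)

lemma runs_output_com:
  assumes n: "nmem s ''n'' 0 = n"
    and z: "nmem s ''og'' = (\<lambda>_. 0)" "nmem s ''om'' = (\<lambda>_. 0)" "nmem s ''lg'' 0 = 0" "nmem s ''lm'' 0 = 0"
  shows "runs output_com s ((100 * n + 100) + ((100 * n + 100) + (5 + 1 + (100 * n + 100))))
    (\<lambda>s'. (\<forall>v\<in>{''pg'', ''pm'', ''mate''}. nmem s' v = nmem s v) \<and>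
      ((\<forall>i<n. nmem s' ''pa'' i = nmem s ''pg'' i) \<and>
         packing_length {..<n} (nmem s ''pg'') \<le> packing_length {..<n} (nmem s ''pm'') \<or>
       (\<forall>i<n. nmem s' ''pa'' i = nmem s ''pm'' i) \<and>
         packing_length {..<n} (nmem s ''pm'') \<le> packing_length {..<n} (nmem s ''pg'')))"
    (is "runs _ _ _ ?Q")
  unfolding output_com_def
proof (rule runs_Seq, rule runs_conseq[OF runs_frame[OF runs_length_com[where n = n]]])
  fix s1 assume s1: "nmem s1 ''lg'' 0 = packing_length {..<n} (nmem s ''pg'') \<and>
    same_off (length_com ''pg'' ''og'' ''lg'') s s1"
  show "runs (Seq (length_com ''pm'' ''om'' ''lm'')
     (Branch (NLe (V ''lg'') (V ''lm'')) (copy_com ''pa'' ''pg'') (copy_com ''pa'' ''pm''))) s1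
     ((100 * n + 100) + (5 + 1 + (100 * n + 100))) ?Q"
  proof (rule runs_Seq, rule runs_conseq[OF runs_frame[OF runs_length_com[where n = n]]])
    fix s2 assume s2: "nmem s2 ''lm'' 0 = packing_length {..<n} (nmem s1 ''pm'') \<and>
      same_off (length_com ''pm'' ''om'' ''lm'') s1 s2"
    have e: "nmem s2 ''lg'' 0 = packing_length {..<n} (nmem s ''pg'')"
      "nmem s2 ''lm'' 0 = packing_length {..<n} (nmem s ''pm'')" "nmem s2 ''n'' 0 = n"
      "\<forall>v\<in>{''pg'', ''pm'', ''mate''}. nmem s2 v = nmem s v"
      using s1 s2 n by (simp_all add: same_off_def mods)
    have "runs (Branch (NLe (V ''lg'') (V ''lm'')) (copy_com ''pa'' ''pg'') (copy_com ''pa'' ''pm'')) s2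
      (bcost (NLe (V ''lg'') (V ''lm'')) + 1 + (100 * n + 100)) ?Q"
    proof (rule runs_Branch)
      assume "bval (NLe (V ''lg'') (V ''lm'')) s2"
      then show "runs (copy_com ''pa'' ''pg'') s2 (100 * n + 100) ?Q"
        by (intro runs_conseq[OF runs_frame[OF runs_copy_com[where n = n]]])
          (use e in \<open>auto simp: same_off_def mods\<close>)
    next
      assume "\<not> bval (NLe (V ''lg'') (V ''lm'')) s2"
      then show "runs (copy_com ''pa'' ''pm'') s2 (100 * n + 100) ?Q"
        by (intro runs_conseq[OF runs_frame[OF runs_copy_com[where n = n]]])
          (use e in \<open>auto simp: same_off_def mods\<close>)
    qed
    then show "runs (Branch (NLe (V ''lg'') (V ''lm'')) (copy_com ''pa'' ''pg'') (copy_com ''pa'' ''pm'')) s2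
      (5 + 1 + (100 * n + 100)) ?Q" by simp
  qed (use s1 n z in \<open>simp_all add: same_off_def mods\<close>)
qed (use n z in simp_all)

lemma performs_app_com:
  assumes ch: "two_bar_charts {..<n} a b" and big: "\<forall>i<n. big a b i"
  shows "performs_app app_com n a b (app_cost n)"
proof -
  let ?s = "input_store n a b"
  have "runs app_com ?s (app_cost n) (\<lambda>s. app_run {..<n} a b (nmem s ''pg'')
    (edges_of_mates n (nmem s ''mate'')) (nmem s ''pm'') (nmem s ''pa''))" (is "runs _ _ _ ?Q")
    unfolding app_com_def app_cost_def
  proof (rule runs_Seq, rule runs_conseq[OF runs_frame[OF runs_match_com[where n = n and a = a and b = b]]])
    fix s1 assume s1: "match_inv n a b n (\<lambda>i. nmem s1 ''done'' i = 0) (nmem s1 ''mate'') \<and>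
      same_off match_com ?s s1"
    have e1: "nmem s1 ''n'' 0 = n" "nmem s1 ''used'' = (\<lambda>_. 0)" "nmem s1 ''og'' = (\<lambda>_. 0)"
      "nmem s1 ''om'' = (\<lambda>_. 0)" "nmem s1 ''lg'' = (\<lambda>_. 0)" "nmem s1 ''lm'' = (\<lambda>_. 0)"
      "rmem s1 ''pb'' 0 = 0" "\<forall>i<n. rmem s1 ''a'' i = a i \<and> rmem s1 ''b'' i = b i"
      using s1 by (simp_all add: same_off_def mods input_store_def)
    show "runs (Seq galo_com (Seq pm_com output_com)) s1
      (((n + n) * (scan_cost galo_guard n + 100) + 100) +
       ((100 * n + 100) + ((100 * n + 100) + ((100 * n + 100) + (5 + 1 + (100 * n + 100)))))) ?Q"
    proof (rule runs_Seq, rule runs_conseq[OF runs_frame[OF runs_galo_com[where n = n and a = a and b = b]]])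
      show "\<forall>i<n. a i \<le> 1" using ch by (auto simp: two_bar_charts_def)
    next
      fix s2 assume s2: "galo_packing {..<n} a b (nmem s2 ''pg'') \<and> same_off galo_com s1 s2"
      have e2: "nmem s2 ''n'' 0 = n" "nmem s2 ''og'' = (\<lambda>_. 0)"
        "nmem s2 ''om'' = (\<lambda>_. 0)" "nmem s2 ''lg'' = (\<lambda>_. 0)" "nmem s2 ''lm'' = (\<lambda>_. 0)"
        "nmem s2 ''mate'' = nmem s1 ''mate''"
        using s2 e1 by (simp_all add: same_off_def mods)
      show "runs (Seq pm_com output_com) s2
        ((100 * n + 100) + ((100 * n + 100) + ((100 * n + 100) + (5 + 1 + (100 * n + 100))))) ?Q"
      proof (rule runs_Seq, rule runs_conseq[OF runs_frame[OF runs_pm_com[where n = n]]])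
        fix s3 assume s3: "(\<forall>i<n. nmem s3 ''pm'' i = 2 * min i (nmem s2 ''mate'' i) + 1) \<and>
          same_off pm_com s2 s3"
        have e3: "nmem s3 ''n'' 0 = n" "nmem s3 ''og'' = (\<lambda>_. 0)"
          "nmem s3 ''om'' = (\<lambda>_. 0)" "nmem s3 ''lg'' 0 = 0" "nmem s3 ''lm'' 0 = 0"
          "nmem s3 ''mate'' = nmem s1 ''mate''" "nmem s3 ''pg'' = nmem s2 ''pg''"
          using s3 e2 by (simp_all add: same_off_def mods)
        have "maximum_matching (chart_edges {..<n} a b) (edges_of_mates n (nmem s3 ''mate''))"
          unfolding e3 using s1 big by (intro match_inv_done) auto
        moreover have "galo_packing {..<n} a b (nmem s3 ''pg'')" using s2 e3(7) by simp
        moreover have "matching_packing {..<n} a b (edges_of_mates n (nmem s3 ''mate'')) (nmem s3 ''pm'')"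
        proof (rule matching_packing_of_mates[OF ch])
          show "\<forall>i<n. nmem s3 ''mate'' i < n \<and> nmem s3 ''mate'' (nmem s3 ''mate'' i) = i \<and>
            (nmem s3 ''mate'' i \<noteq> i \<longrightarrow> adj a b i (nmem s3 ''mate'' i))"
            using s1 unfolding e3 match_inv_def by blast
          show "\<forall>i<n. nmem s3 ''pm'' i = 2 * min i (nmem s3 ''mate'' i) + 1"
            using s3 e2(6) e3(6) by simp
        qed
        ultimately show "runs output_com s3
          ((100 * n + 100) + ((100 * n + 100) + (5 + 1 + (100 * n + 100)))) ?Q"
          by (intro runs_conseq[OF runs_output_com[where n = n]])
            (use e3 in \<open>auto simp: app_run_def\<close>)
      qed (use e2 in simp_all)
    qed (use e1 in simp_all)
  qed (use big in \<open>simp_all add: input_store_def\<close>)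
  then show ?thesis unfolding runs_def performs_app_def .
qed

text \<open>There are \<open>2 n\<close> scans for GALO and at most \<open>2 n\<close> for the
  matching, each of linear cost, so the cost is quadratic.\<close>

lemma app_cost_bigo: "(\<lambda>n. real (app_cost n)) \<in> O(\<lambda>n. real n powr (5/2))"
proof (rule bigoI)
  show "\<forall>\<^sub>F n in sequentially. norm (real (app_cost n)) \<le> 5000 * norm (real n powr (5/2))"
    using eventually_ge_at_top[of 1]
  proof eventually_elim
    case (elim n)
    have "n \<le> n * n" "1 \<le> n * n" using elim by simp_all
    moreover have "app_cost n = 606 + 980 * n + 323 * (n * n)"
      by (simp add: app_cost_def scan_cost_def galo_guard_def head_guard_def mate_guard_def
          algebra_simps)
    ultimately have "app_cost n \<le> 5000 * (n * n)" by linarith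
    then have "real (app_cost n) \<le> 5000 * real n powr 2"
      using elim of_nat_mono[of "app_cost n" "5000 * (n * n)", where ?'a = real]
      by (simp add: power2_eq_square)
    also have "\<dots> \<le> 5000 * real n powr (5/2)"
      using elim by (intro mult_left_mono powr_mono) simp_all
    finally show ?case by simp
  qed
qed

text \<open>The guarantee covers every run of App, hence also the packing that the program leaves in
  \<open>pa\<close>.\<close>

theorem theorem3:
  shows "(\<forall>(S :: 'i set) a b pg M pm pa.
            two_bar_charts S a b \<and> (\<forall>i\<in>S. big a b i) \<and> app_run S a b pg M pm pa \<longrightarrow>
            feasible S a b pa \<and>
            real (packing_length S pa) \<le> 4/3 * real (OPT S a b) + 2/3) \<and>
         (\<exists>(c :: com) (T :: nat \<Rightarrow> nat).
            (\<lambda>n. real (T n)) \<in> O(\<lambda>n. real n powr (5/2)) \<and>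
            (\<forall>n a b. two_bar_charts {..<n} a b \<and> (\<forall>i<n. big a b i) \<longrightarrow>
               performs_app c n a b (T n))) \<and>
         (\<exists>(S :: nat set) a b pg M pm pa.
            two_bar_charts S a b \<and> (\<forall>i\<in>S. big a b i) \<and> app_run S a b pg M pm pa \<and>
            real (packing_length S pa) = 4/3 * real (OPT S a b) + 2/3)"
proof (intro conjI)
  show "\<exists>(c :: com) (T :: nat \<Rightarrow> nat).
      (\<lambda>n. real (T n)) \<in> O(\<lambda>n. real n powr (5/2)) \<and>
      (\<forall>n a b. two_bar_charts {..<n} a b \<and> (\<forall>i<n. big a b i) \<longrightarrow> performs_app c n a b (T n))"
    using app_cost_bigo performs_app_com by blast
qed (use app_guarantee app_guarantee_tight in blast)+

end
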